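(* Let $\rho\in\mathcal{O}_K$ be a prime element with $\rho\nmid T$. If \[ |N_{K/\mathbb{Q}}(\rho)| > \frac{\sqrt{(4n)!}}{\pi^n 3^{n/2} n^{2n}}\cdot d_K\sqrt{N_{K/\mathbb{Q}}(T)}, \] then $\rho$ is $\mathcal{H}$-suitable.
   Context: Let $K$ be a totally real number field of degree $n$ over $\mathbb{Q}$ with discriminant $d_K$, real embeddings $\sigma_1,\dots,\sigma_n$, and ring of integers $\mathcal{O}_K$ a unique factorization domain; regard $K\subset\mathbb{R}$ via $\sigma_1$. $N_{K/\mathbb{Q}}(\lambda)=\sigma_1(\lambda)\cdots\sigma_n(\lambda)$; $\lambda$ is totally positive if all $\sigma_t(\lambda)>0$. Let $i,j,k$ be the real quaternion units with $i^2=j^2=k^2=ijk=-1$; for $L=x+yi+zj+wk$ put $\overline{L}=x-yi-zj-wk$ and $N(L)=L\overline{L}=x^2+y^2+z^2+w^2$. Fix $A,B,\mu,\nu\in\mathcal{O}_K$ such that $S=4A-\mu^2$ and $T=BS-\nu^2$ are totally positive; put $\alpha=\frac{\mu+i\sqrt{S}}{2}$, $\beta=\frac{\nu i+j\sqrt{T}}{\sqrt{S}}$, and $\mathcal{H}=\{x+y\alpha+z\beta+w\alpha\beta : x,y,z,w\in\mathcal{O}_K\}$ (a ring; quaternion norms of its elements lie in $\mathcal{O}_K$). The double norm is $\mathcal{N}=N_{K/\mathbb{Q}}\circ N$. For $L\in\mathcal{H}$, "$\rho\mid L$" means $L\in\rho\mathcal{H}$. A prime element $\rho\in\mathcal{O}_K$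 is called $\mathcal{H}$-suitable if for every $L\in\mathcal{H}$ with $\rho\nmid L$, the set $\mathcal{H}\frac{L}{\rho}+\mathcal{H}=\{D\frac{L}{\rho}+C : C,D\in\mathcal{H}\}$ contains a nonzero element $L'$ with $\mathcal{N}(L')<1$. *)

theory Defs
  imports
    "HOL-Analysis.Analysis"
    "HOL-Algebra.Algebra"
    "HOL-Algebra.Algebraic_Closure_Type"
    "HOL-Computational_Algebra.Polynomial"
begin

section \<open>Real quaternions\<close>

datatype quaternion = Quat (qRe: real) (qI: real) (qJ: real) (qK: real)

lemma quaternion_eq_iff:
  "x = y \<longleftrightarrow> qRe x = qRe y \<and> qI x = qI y \<and> qJ x = qJ y \<and> qK x = qK y"
  by (auto intro: quaternion.expand)

instantiation quaternion :: real_algebra_1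
begin

definition "0 = Quat 0 0 0 0"
definition "1 = Quat 1 0 0 0"
definition "x + y = Quat (qRe x + qRe y) (qI x + qI y) (qJ x + qJ y) (qK x + qK y)"
definition "- x = Quat (- qRe x) (- qI x) (- qJ x) (- qK x)"
definition "x - y = Quat (qRe x - qRe y) (qI x - qI y) (qJ x - qJ y) (qK x - qK y)"
definition "x * y = Quat
  (qRe x * qRe y - qI x * qI y - qJ x * qJ y - qK x * qK y)
  (qRe x * qI y + qI x * qRe y + qJ x * qK y - qK x * qJ y)
  (qRe x * qJ y - qI x * qK y + qJ x * qRe y + qK x * qI y)
  (qRe x * qK y + qI x * qJ y - qJ x * qI y + qK x * qRe y)"
definition "r *\<^sub>R x = Quat (r * qRe x) (r * qI x) (r * qJ x) (r * qK x)"

instance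
  by standard
    (simp_all add: quaternion_eq_iff zero_quaternion_def one_quaternion_def plus_quaternion_def
      uminus_quaternion_def minus_quaternion_def times_quaternion_def scaleR_quaternion_def
      algebra_simps)

end

definition quat_i :: quaternion where "quat_i = Quat 0 1 0 0"
definition quat_j :: quaternion where "quat_j = Quat 0 0 1 0"
definition quat_k :: quaternion where "quat_k = Quat 0 0 0 1"

lemma quat_units:
  "quat_i * quat_i = -1" "quat_j * quat_j = -1" "quat_k * quat_k = -1"
  "quat_i * quat_j * quat_k = -1"
  by (simp_all add: quaternion_eq_iff quat_i_def quat_j_def quat_k_def one_quaternion_def
      uminus_quaternion_def times_quaternion_def)

definition quat_conj :: "quaternion \<Rightarrow> quaternion" where
  "quat_conj L = Quat (qRe L) (- qI L) (- qJ L) (- qK L)"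

definition quat_norm :: "quaternion \<Rightarrow> real" where
  "quat_norm L = (qRe L)\<^sup>2 + (qI L)\<^sup>2 + (qJ L)\<^sup>2 + (qK L)\<^sup>2"

lemma of_real_quat_norm: "of_real (quat_norm L) = L * quat_conj L"
  by (simp add: quaternion_eq_iff of_real_def quat_norm_def quat_conj_def one_quaternion_def
      times_quaternion_def scaleR_quaternion_def power2_eq_square)


section \<open>Totally real number fields inside the reals\<close>

abbreviation ring_on :: "'a::ring_1 set \<Rightarrow> 'a ring" where
  "ring_on U \<equiv> ring_of_type_algebra \<lparr>carrier := U\<rparr>"

definition number_field_of_degree :: "nat \<Rightarrow> real set \<Rightarrow> bool" where
  "number_field_of_degree n K \<longleftrightarrow>
     subfield K ring_of_type_algebra \<and> ring.dimension ring_of_type_algebra n \<rat> K"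

definition totally_real :: "real set \<Rightarrow> bool" where
  "totally_real K \<longleftrightarrow>
     (\<forall>f \<in> ring_hom (ring_on K) (ring_of_type_algebra :: complex ring). f ` K \<subseteq> \<real>)"

text \<open>Embeddings are made extensional so that two of them are equal iff they agree on the field.\<close>

definition real_embeddings :: "real set \<Rightarrow> (real \<Rightarrow> real) set" where
  "real_embeddings K = ring_hom (ring_on K) ring_of_type_algebra \<inter> extensional K"

definition ring_of_integers :: "real set \<Rightarrow> real set" where
  "ring_of_integers K = {x \<in> K. algebraic_int x}"

text \<open>
  Below, the finite type \<open>'n\<close> indexes the embeddings \<open>\<sigma>\<close> of the field, so that the degree is
  \<open>CARD('n)\<close>.
\<close>

definition field_norm :: "('n::finite \<Rightarrow> real \<Rightarrow> real) \<Rightarrow> real \<Rightarrow> real" where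
  "field_norm \<sigma> x = (\<Prod>t\<in>UNIV. \<sigma> t x)"

definition totally_positive :: "('n::finite \<Rightarrow> real \<Rightarrow> real) \<Rightarrow> real \<Rightarrow> bool" where
  "totally_positive \<sigma> x \<longleftrightarrow> (\<forall>t. \<sigma> t x > 0)"

definition integral_basis :: "real set \<Rightarrow> ('n::finite \<Rightarrow> real) \<Rightarrow> bool" where
  "integral_basis K b \<longleftrightarrow>
     bij_betw (\<lambda>c :: 'n \<Rightarrow> int. \<Sum>t\<in>UNIV. of_int (c t) * b t) UNIV (ring_of_integers K)"

text \<open>The value does not depend on the chosen integral basis: a change of basis has determinant
  \<open>\<plusminus>1\<close>.\<close>

definition discriminant :: "real set \<Rightarrow> ('n::finite \<Rightarrow> real \<Rightarrow> real) \<Rightarrow> real" where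
  "discriminant K \<sigma> =
     (let b = (SOME b :: 'n \<Rightarrow> real. integral_basis K b)
      in (det (\<chi> s t. \<sigma> s (b t)))\<^sup>2)"


section \<open>The quaternion ring and suitable primes\<close>

definition quat_alpha :: "real \<Rightarrow> real \<Rightarrow> quaternion" where
  "quat_alpha \<mu> S = (of_real \<mu> + quat_i * of_real (sqrt S)) /\<^sub>R 2"

definition quat_beta :: "real \<Rightarrow> real \<Rightarrow> real \<Rightarrow> quaternion" where
  "quat_beta \<nu> S T = (of_real \<nu> * quat_i + quat_j * of_real (sqrt T)) /\<^sub>R sqrt S"

definition quat_order :: "real set \<Rightarrow> real \<Rightarrow> real \<Rightarrow> real \<Rightarrow> real \<Rightarrow> quaternion set" where
  "quat_order K \<mu> \<nu> S T =
     {of_real x + of_real y * quat_alpha \<mu> S + of_real z * quat_beta \<nu> S T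
        + of_real w * (quat_alpha \<mu> S * quat_beta \<nu> S T) | x y z w.
      x \<in> ring_of_integers K \<and> y \<in> ring_of_integers K \<and>
      z \<in> ring_of_integers K \<and> w \<in> ring_of_integers K}"

definition double_norm :: "('n::finite \<Rightarrow> real \<Rightarrow> real) \<Rightarrow> quaternion \<Rightarrow> real" where
  "double_norm \<sigma> L = field_norm \<sigma> (quat_norm L)"

definition prime_element :: "real set \<Rightarrow> real \<Rightarrow> bool" where
  "prime_element K \<rho> \<longleftrightarrow>
     \<rho> \<in> ring_of_integers K \<and> ring_prime\<^bsub>ring_on (ring_of_integers K)\<^esub> \<rho>"

definition quat_suitable ::
  "real set \<Rightarrow> ('n::finite \<Rightarrow> real \<Rightarrow> real) \<Rightarrow> quaternion set \<Rightarrow> real \<Rightarrow> bool" where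
  "quat_suitable K \<sigma> H \<rho> \<longleftrightarrow>
     prime_element K \<rho> \<and>
     (\<forall>L\<in>H. L \<notin> (\<lambda>M. \<rho> *\<^sub>R M) ` H \<longrightarrow>
        (\<exists>L' \<in> {D * (L /\<^sub>R \<rho>) + C | C D. C \<in> H \<and> D \<in> H}. L' \<noteq> 0 \<and> double_norm \<sigma> L' < 1))"

end

theory Submission
  imports Defs "HOL-Probability.Probability" "HOL-Real_Asymp.Real_Asymp"
begin

text \<open>
  Let \<open>L\<close> not be divisible by the prime \<open>\<rho>\<close>. Modulo \<open>\<rho>\<close> the left ideal generated by \<open>L\<close> has dimension
  at least 2: otherwise \<open>\<alpha>\<close> and \<open>\<beta>\<close> act on the class of \<open>L\<close> by scalars, so their commutator kills it,
  although the square of the commutator is \<open>-T\<close>, which is invertible modulo \<open>\<rho>\<close>. Hence the left ideal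
  generated by \<open>L\<close> and \<open>\<rho>\<close> contains a free module over the integers of \<open>K\<close> with coefficient
  determinant \<open>\<rho>\<^sup>2\<close>. Under all embeddings it becomes a lattice in the \<open>n\<close>-th power of the quaternions with
  covolume \<open>d\<^sub>K\<^sup>2 N(T) N(\<rho>)\<^sup>2 / 4\<^sup>n\<close>. Minkowski's theorem for the body of all tuples with
  \<open>\<Sum>\<^sub>s |y\<^sub>s| < n |N(\<rho>)|\<^sup>1\<^sup>/\<^sup>n\<close>, whose volume is \<open>(12 \<pi>\<^sup>2)\<^sup>n / (4n)!\<close> times the \<open>4n\<close>-th power of the radius,
  gives a nonzero element, and the inequality of arithmetic and geometric means bounds its double norm
  by \<open>N(\<rho>)\<^sup>2\<close>.
\<close>

no_notation fps_nth (infixl "$" 75)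

section \<open>Minkowski's theorem\<close>

text \<open>The threshold is Minkowski's condition solved for q = |N(\<rho>)|. With radius n q^(1/n)
  the body has volume (12 \<pi>^2)^n n^(4n) q^4 / (4n)!, and this must exceed 2^(4n) times the
  covolume, that is, 4^n d_K^2 N(T) q^2. Cancelling 4^n q^2 leaves a lower bound on q^2 whose square
  root is the hypothesis. The gain of q^2 comes from rank 2: two of the four directions modulo
  \<rho> lie in the ideal, so the covolume carries q^2, whereas \<rho> times the whole order would
  carry q^4 and \<rho> would cancel altogether. The gauge sums norms and not their squares, so that
  the mean inequality bounds the product of the norms by q; the double norm is the square of that
  product. Two arithmetic facts have to be supplied on the way: an integral basis exists, since the
  discriminant is defined through a chosen one, and elements not divisible by \<rho> are invertible
  modulo \<rho>, which is drawn from the finiteness of the residues and not from a residue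
  field.\<close>

lemma emeasure_unit_cube_cart:
  "emeasure lborel (cbox 0 (\<chi> i. 1) :: (real^'m) set) = 1"
proof -
  have "emeasure lborel (cbox 0 (\<chi> i. 1) :: (real^'m) set)
      = ennreal (\<Prod>b\<in>Basis. ((\<chi> i. 1) - 0) \<bullet> (b :: real^'m))"
    by (rule emeasure_lborel_cbox) (auto simp: Basis_vec_def simp flip: cart_eq_inner_axis)
  also have "(\<Prod>b\<in>Basis. ((\<chi> i. 1) - 0) \<bullet> (b :: real^'m)) = 1"
    by (rule prod.neutral) (auto simp: Basis_vec_def simp flip: cart_eq_inner_axis)
  finally show ?thesis by simp
qed

text \<open>Cut \<open>S\<close> along the integer translates of the half-open unit cube and move
  every piece into that cube. If no two points of \<open>S\<close> differed by an integer vector,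
  the moved pieces would be disjoint, and their total volume, that of \<open>S\<close>, would be at
  most 1.\<close>

lemma blichfeldt:
  fixes S :: "(real^'m) set"
  assumes S: "S \<in> sets borel" and large: "emeasure lborel S > 1"
  shows "\<exists>x\<in>S. \<exists>y\<in>S. x \<noteq> y \<and> (\<forall>i. x $ i - y $ i \<in> \<int>)"
proof (rule ccontr)
  assume neg: "\<not> ?thesis"
  define Z :: "(real^'m) set" where "Z = range (\<lambda>c :: int^'m. \<chi> i. of_int (c $ i))"
  define Q :: "(real^'m) set" where "Q = {x. \<forall>i. 0 \<le> x $ i \<and> x $ i < 1}"
  define F where "F z = {x \<in> Q. x + z \<in> S}" for z
  define G where "G z = {x \<in> S. x - z \<in> Q}" for z
  have Z_Ints: "z $ i \<in> \<int>" if "z \<in> Z" for z i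
    using that by (auto simp: Z_def)
  have "countable (range (\<lambda>f :: 'm \<Rightarrow> int. (\<chi> i. of_int (f i)) :: real^'m))"
    by (intro countable_image countableI_type)
  then have cZ: "countable Z"
    by (rule countable_subset[rotated]) (auto simp: Z_def)
  have [measurable]: "Q \<in> sets borel"
    unfolding Q_def by measurable
  note S[measurable]
  have [measurable]: "F z \<in> sets borel" "G z \<in> sets borel" for z
    unfolding F_def G_def by measurable
  have FG: "emeasure lborel (F z) = emeasure lborel (G z)" for z
  proof -
    have "emeasure lborel (G z) = emeasure (distr lborel borel ((+) z)) (G z)"
      by (simp add: lborel_distr_plus)
    also have "\<dots> = emeasure lborel ((+) z -` G z)"
      by (subst emeasure_distr) auto
    also have "(+) z -` G z = F z"
      by (auto simp: F_def G_def add.commute)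
    finally show ?thesis ..
  qed
  \<comment> \<open>This is where the negated conclusion enters: a point \<open>x\<close> in two
    moved pieces comes from \<open>x + z\<close> and \<open>x + w\<close> in \<open>S\<close>, whose
    difference is an integer vector. The unmoved pieces \<open>G z\<close> are disjoint for every
    \<open>S\<close>.\<close>
  have "disjoint_family_on F Z"
    unfolding disjoint_family_on_def
  proof (intro ballI impI)
    fix z w assume zw: "z \<in> Z" "w \<in> Z" "z \<noteq> w"
    show "F z \<inter> F w = {}"
    proof (rule ccontr)
      assume "F z \<inter> F w \<noteq> {}"
      then obtain x where "x + z \<in> S" "x + w \<in> S"
        by (auto simp: F_def)
      moreover have "(x + z) $ i - (x + w) $ i \<in> \<int>" for i
        using Ints_diff[OF Z_Ints[OF zw(1)] Z_Ints[OF zw(2)]] by simp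
      ultimately show False
        using neg zw(3) by (metis add_left_cancel)
    qed
  qed
  \<comment> \<open>Half-openness of the cube makes the cell of a point unique: its corner is the
    vector of floors.\<close>
  have floor_eq: "z $ i = of_int \<lfloor>x $ i\<rfloor>" if z: "z \<in> Z" "x - z \<in> Q" for x z i
  proof -
    obtain c :: int where c: "z $ i = of_int c"
      using Z_Ints[OF z(1)] by (auto elim: Ints_cases)
    have "0 \<le> x $ i - of_int c" "x $ i - of_int c < 1"
      using z(2) c unfolding Q_def by (auto simp flip: c)
    then have "\<lfloor>x $ i\<rfloor> = c"
      by linarith
    with c show ?thesis by simp
  qed
  have "disjoint_family_on G Z"
    unfolding disjoint_family_on_def
  proof (intro ballI impI)
    fix z w assume zw: "z \<in> Z" "w \<in> Z" "z \<noteq> w"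
    have False if "x \<in> G z" "x \<in> G w" for x
      using zw floor_eq[of z x] floor_eq[of w x] that by (simp add: G_def vec_eq_iff)
    then show "G z \<inter> G w = {}"
      by auto
  qed
  have UG: "(\<Union>z\<in>Z. G z) = S"
  proof -
    have "x \<in> G (\<chi> i. of_int \<lfloor>x $ i\<rfloor>)" "(\<chi> i. of_int \<lfloor>x $ i\<rfloor>) \<in> Z" if "x \<in> S" for x
    proof -
      show "x \<in> G (\<chi> i. of_int \<lfloor>x $ i\<rfloor>)"
        using that by (auto simp: G_def Q_def; linarith)
      show "(\<chi> i. of_int \<lfloor>x $ i\<rfloor>) \<in> Z"
        unfolding Z_def by (rule range_eqI[of _ _ "\<chi> i. \<lfloor>x $ i\<rfloor>"]) simp
    qed
    then show ?thesis
      by (auto simp: G_def)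
  qed
  have "emeasure lborel S = emeasure lborel (\<Union>z\<in>Z. G z)"
    by (simp add: UG)
  also have "\<dots> = (\<integral>\<^sup>+z. emeasure lborel (G z) \<partial>count_space Z)"
    by (rule emeasure_UN_countable) (use cZ \<open>disjoint_family_on G Z\<close> in auto)
  also have "\<dots> = (\<integral>\<^sup>+z. emeasure lborel (F z) \<partial>count_space Z)"
    by (simp add: FG)
  also have "\<dots> = emeasure lborel (\<Union>z\<in>Z. F z)"
    by (rule emeasure_UN_countable[symmetric]) (use cZ \<open>disjoint_family_on F Z\<close> in auto)
  also have "\<dots> \<le> emeasure lborel (cbox 0 (\<chi> i. 1) :: (real^'m) set)"
    by (rule emeasure_mono) (auto simp: F_def Q_def mem_box_cart less_imp_le)
  also have "\<dots> = 1"
    by (rule emeasure_unit_cube_cart)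
  finally show False
    using large by simp
qed

lemma emeasure_sublevel_homogeneous:
  fixes g :: "'a::euclidean_space \<Rightarrow> real"
  assumes [measurable]: "g \<in> borel_measurable borel"
    and hom: "\<And>c x. c > 0 \<Longrightarrow> g (c *\<^sub>R x) = c * g x" and "r > 0"
  shows "emeasure lborel {x. g x < r} = ennreal (r ^ DIM('a)) * emeasure lborel {x. g x < 1}"
proof -
  have "emeasure lborel {x. g x < r}
      = emeasure (density (distr lborel borel (\<lambda>x. 0 + r *\<^sub>R x)) (\<lambda>_. \<bar>r\<bar> ^ DIM('a))) {x. g x < r}"
    using lborel_affine[of r "0::'a"] \<open>r > 0\<close> by simp
  also have "\<dots> = ennreal (r ^ DIM('a)) * emeasure lborel {x. g (r *\<^sub>R x) < r}"
    using \<open>r > 0\<close>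
    by (subst emeasure_density_const) (auto simp: emeasure_distr)
  also have "{x. g (r *\<^sub>R x) < r} = {x. g x < 1}"
    using \<open>r > 0\<close> by (auto simp: hom)
  finally show ?thesis .
qed

text \<open>The symmetric convex body is presented as an open ball of a seminorm. Blichfeldt's lemma
  for the ball of half the radius gives two points whose difference is integral and, by symmetry and
  subadditivity, lies in the full ball. The lattice is always Z^m; another lattice enters by
  composing \<open>f\<close> with a matrix.\<close>

theorem minkowski_gauge:
  fixes f :: "real^'m \<Rightarrow> real"
  assumes [measurable]: "f \<in> borel_measurable borel"
    and triangle: "\<And>x y. f (x + y) \<le> f x + f y"
    and hom: "\<And>c x. f (c *\<^sub>R x) = \<bar>c\<bar> * f x"
    and "r > 0" and large: "emeasure lborel {x. f x < r} > 2 ^ CARD('m)"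
  shows "\<exists>z :: int^'m. z \<noteq> 0 \<and> f (\<chi> i. of_int (z $ i)) < r"
proof -
  have "emeasure lborel {x. f x < r / 2} > 1"
  proof -
    \<comment> \<open>The gauge is rescaled to \<open>2 / r * f\<close>: its sublevel sets at 2 and
      at 1 are the balls of radius \<open>r\<close> and \<open>r / 2\<close>.\<close>
    have "emeasure lborel {x. f x < r} = ennreal (2 ^ CARD('m)) * emeasure lborel {x. f x < r / 2}"
      using emeasure_sublevel_homogeneous[of "\<lambda>x. 2 / r * f x" 2] \<open>r > 0\<close>
      by (simp add: hom field_simps)
    with large have *: "2 ^ CARD('m) < 2 ^ CARD('m) * emeasure lborel {x. f x < r / 2}"
      by (simp flip: ennreal_power)
    show ?thesis
    proof (rule ccontr)
      assume "\<not> ?thesis"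
      then have "2 ^ CARD('m) * emeasure lborel {x. f x < r / 2} \<le> 2 ^ CARD('m) * (1 :: ennreal)"
        by (intro mult_left_mono) auto
      with * show False by simp
    qed
  qed
  then obtain x y where xy: "f x < r / 2" "f y < r / 2" "x \<noteq> y" "\<And>i. x $ i - y $ i \<in> \<int>"
    using blichfeldt[of "{x. f x < r / 2}"] by auto
  then have "\<exists>c. x $ i - y $ i = of_int c" for i
    by (auto elim: Ints_cases)
  then obtain c where c: "\<And>i. x $ i - y $ i = of_int (c i)"
    by metis
  have eq: "(\<chi> i. of_int ((\<chi> i. c i) $ i)) = x - y"
    by (simp add: vec_eq_iff c)
  have "f (x - y) \<le> f x + f (- 1 *\<^sub>R y)"
    using triangle[of x "- y"] by simp
  also have "\<dots> < r"
    using xy by (subst hom) simp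
  finally have "f (x - y) < r" .
  moreover have "(\<chi> i. c i) \<noteq> 0"
  proof
    assume "(\<chi> i. c i) = 0"
    then have "c i = 0" for i
      by (simp add: vec_eq_iff)
    with c xy(3) show False
      by (simp add: vec_eq_iff)
  qed
  ultimately show ?thesis
    using eq by (intro exI[of _ "\<chi> i. c i"]) auto
qed

text \<open>The integral of \<open>exp (- g)\<close> determines the volume of the unit ball of \<open>g\<close>, and it factorises when
  \<open>g\<close> is a sum over blocks of coordinates.\<close>

lemma nn_integral_exp_homogeneous:
  fixes g :: "'a::euclidean_space \<Rightarrow> real"
  assumes [measurable]: "g \<in> borel_measurable borel"
    and hom: "\<And>c x. c > 0 \<Longrightarrow> g (c *\<^sub>R x) = c * g x" and nonneg: "\<And>x. g x \<ge> 0"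
  shows "(\<integral>\<^sup>+x. ennreal (exp (- g x)) \<partial>lborel) = ennreal (fact (DIM('a))) * emeasure lborel {x. g x < 1}"
proof -
  have exp_tail_0: "((\<lambda>s. - exp (- s)) \<longlongrightarrow> (0::real)) at_top"
    by real_asymp
  \<comment> \<open>Writing exp(-g(x)) as the integral of exp(-s) over s > g(x) and exchanging the
    integrals leaves volumes of sublevel sets. These scale like s^d for d = \<open>DIM('a)\<close>,
    and the integral of s^d exp(-s) over s \<ge> 0 is d!.\<close>
  have exp_tail: "ennreal (exp (- a)) = (\<integral>\<^sup>+s. ennreal (exp (- s)) * indicator {a<..} s \<partial>lborel)" for a :: real
  proof -
    have "(\<integral>\<^sup>+s. ennreal (exp (- s)) * indicator {a<..} s \<partial>lborel)
        = (\<integral>\<^sup>+s. ennreal (exp (- s)) * indicator {a..} s \<partial>lborel)"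
      by (intro nn_integral_cong_AE) (use AE_lborel_singleton[of a] in \<open>auto split: split_indicator\<close>)
    also have "\<dots> = ennreal (0 - (- exp (- a)))"
      by (rule nn_integral_FTC_atLeast)
        (auto intro!: derivative_eq_intros exp_tail_0)
    finally show ?thesis by simp
  qed
  have "(\<integral>\<^sup>+x. ennreal (exp (- g x)) \<partial>lborel)
      = (\<integral>\<^sup>+x. (\<integral>\<^sup>+s. ennreal (exp (- s)) * indicator {g x<..} s \<partial>lborel) \<partial>lborel)"
    by (simp flip: exp_tail)
  also have "\<dots> = (\<integral>\<^sup>+s. (\<integral>\<^sup>+x. ennreal (exp (- s)) * indicator {g x<..} s \<partial>lborel) \<partial>lborel)"
    by (rule lborel_pair.Fubini') (auto simp: indicator_def[abs_def] greaterThan_def)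
  also have "\<dots> = (\<integral>\<^sup>+s. ennreal (s ^ DIM('a) * exp (- s)) * indicator {0..} s * emeasure lborel {x. g x < 1} \<partial>lborel)"
  proof (rule nn_integral_cong_AE, use AE_lborel_singleton[of 0] in eventually_elim)
    fix s :: real assume "s \<noteq> 0"
    have "(\<integral>\<^sup>+x. ennreal (exp (- s)) * indicator {g x<..} s \<partial>lborel)
        = (\<integral>\<^sup>+x. ennreal (exp (- s)) * indicator {x. g x < s} x \<partial>lborel)"
      by (intro nn_integral_cong) (auto split: split_indicator)
    also have "\<dots> = ennreal (exp (- s)) * emeasure lborel {x. g x < s}"
      by (rule nn_integral_cmult_indicator) auto
    also have "\<dots> = ennreal (s ^ DIM('a) * exp (- s)) * indicator {0..} s * emeasure lborel {x. g x < 1}"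
    proof (cases "s > 0")
      case True
      then show ?thesis
        by (subst emeasure_sublevel_homogeneous[OF _ hom]) (auto simp: ennreal_mult' mult_ac)
    next
      case False
      then have "s < 0" using \<open>s \<noteq> 0\<close> by simp
      then have "{x. g x < s} = {}"
        using nonneg by (auto simp: not_less intro: order.strict_implies_order order.trans)
      with \<open>s < 0\<close> show ?thesis by simp
    qed
    finally show "(\<integral>\<^sup>+x. ennreal (exp (- s)) * indicator {g x<..} s \<partial>lborel) = \<dots>" .
  qed
  also have "\<dots> = ennreal (fact (DIM('a))) * emeasure lborel {x. g x < 1}"
    by (subst nn_integral_multc) (auto simp: nn_intergal_power_times_exp_Ici)
  finally show ?thesis .
qed

section \<open>Lebesgue measure and blocks of coordinates\<close>

lemma borel_measurable_vec_lambda [measurable (raw)]: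
  fixes f :: "'a \<Rightarrow> 'm::finite \<Rightarrow> real"
  assumes "\<And>i. (\<lambda>x. f x i) \<in> borel_measurable M"
  shows "(\<lambda>x. \<chi> i. f x i) \<in> borel_measurable M"
proof (subst borel_measurable_euclidean_space, intro ballI)
  fix b :: "real^'m" assume "b \<in> Basis"
  then obtain i where "b = axis i 1"
    by (auto simp: Basis_vec_def)
  then show "(\<lambda>x. (\<chi> i. f x i) \<bullet> b) \<in> borel_measurable M"
    using assms[of i] by (simp flip: cart_eq_inner_axis)
qed

lemma borel_measurable_vec_nth [measurable (raw)]:
  fixes f :: "'a \<Rightarrow> real^'m"
  assumes [measurable]: "f \<in> borel_measurable M"
  shows "(\<lambda>x. f x $ i) \<in> borel_measurable M"
  by (simp add: cart_eq_inner_axis)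

lemma borel_measurable_matrix_vector_mult [measurable]:
  fixes A :: "real^'m^'k"
  shows "(\<lambda>x. A *v x) \<in> borel_measurable borel"
  unfolding matrix_vector_mult_def by measurable

lemma prod_Basis_cart:
  fixes F :: "real^'m \<Rightarrow> 'b::comm_monoid_mult"
  shows "(\<Prod>b\<in>Basis. F b) = (\<Prod>i\<in>UNIV. F (axis i 1))"
proof -
  have "(Basis :: (real^'m) set) = (\<lambda>i. axis i 1) ` UNIV"
    by (auto simp: Basis_vec_def)
  moreover have "inj (\<lambda>i. axis i 1 :: real^'m)"
    by (auto simp: inj_on_def axis_eq_axis)
  ultimately show ?thesis
    by (metis (no_types, lifting) comp_apply prod.cong prod.reindex)
qed

lemma emeasure_lborel_box_cart:
  fixes l u :: "real^'m"
  assumes "\<And>i. l $ i \<le> u $ i"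
  shows "emeasure lborel (box l u) = ennreal (\<Prod>i\<in>UNIV. u $ i - l $ i)"
proof -
  have "emeasure lborel (box l u) = ennreal (\<Prod>b\<in>Basis. (u - l) \<bullet> b)"
    by (rule emeasure_lborel_box) (use assms in \<open>auto simp: Basis_vec_def simp flip: cart_eq_inner_axis\<close>)
  then show ?thesis
    by (simp add: prod_Basis_cart flip: cart_eq_inner_axis)
qed

lemma lborel_cart_eqI:
  fixes M :: "(real^'m) measure"
  assumes "\<And>l u. (\<And>i. l $ i \<le> u $ i) \<Longrightarrow> emeasure M (box l u) = ennreal (\<Prod>i\<in>UNIV. u $ i - l $ i)"
    and "sets M = sets borel"
  shows "lborel = M"
proof (rule lborel_eqI[OF _ assms(2)])
  fix l u :: "real^'m" assume *: "\<And>b. b \<in> Basis \<Longrightarrow> l \<bullet> b \<le> u \<bullet> b"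
  have "l $ i \<le> u $ i" for i
    using *[of "axis i 1"] by (simp add: cart_eq_inner_axis)
  then show "emeasure M (box l u) = ennreal (\<Prod>b\<in>Basis. (u - l) \<bullet> b)"
    by (simp add: assms(1) prod_Basis_cart flip: cart_eq_inner_axis)
qed

lemma lborel_cart_PiM:
  "(lborel :: (real^'m) measure) = distr (Pi\<^sub>M UNIV (\<lambda>_::'m. lborel)) borel (\<lambda>f. \<chi> i. f i)"
proof (rule lborel_cart_eqI)
  interpret product_sigma_finite "\<lambda>_::'m. lborel :: real measure"
    by standard
  fix l u :: "real^'m" assume lu: "\<And>i. l $ i \<le> u $ i"
  have "(\<lambda>f. \<chi> i. f i) -` box l u \<inter> space (Pi\<^sub>M UNIV (\<lambda>_::'m. lborel))
      = (\<Pi>\<^sub>E i\<in>UNIV. box (l $ i) (u $ i))"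
    by (auto simp: space_PiM PiE_iff mem_box_cart)
  then show "emeasure (distr (Pi\<^sub>M UNIV (\<lambda>_::'m. lborel)) borel (\<lambda>f. \<chi> i. f i)) (box l u)
      = ennreal (\<Prod>i\<in>UNIV. u $ i - l $ i)"
    using lu by (subst emeasure_distr) (auto simp: emeasure_PiM prod_ennreal)
qed simp

text \<open>Lebesgue measure is determined by boxes, and a box is a product of smaller boxes over
  the blocks. The map \<open>h\<close> assigns to block \<open>a\<close> and position
  \<open>b\<close> a coordinate, and \<open>p\<close> inverts it. The grouping stays arbitrary
  because coordinates indexed by \<open>'n \<times> 4\<close> are later grouped both by embedding
  and by quaternion coordinate.\<close>

lemma lborel_blocks:
  fixes h :: "'a::finite \<Rightarrow> 'b::finite \<Rightarrow> 'm::finite"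
  assumes h: "bij (\<lambda>(a, b). h a b)"
    and fs: "\<And>a b. fst (p (h a b)) = a" "\<And>a b. snd (p (h a b)) = b"
  shows "(lborel :: (real^'m) measure) =
    distr (Pi\<^sub>M UNIV (\<lambda>_::'a. lborel :: (real^'b) measure)) borel (\<lambda>f. \<chi> m. f (fst (p m)) $ snd (p m))"
proof (rule lborel_cart_eqI)
  interpret product_sigma_finite "\<lambda>_::'a. lborel :: (real^'b) measure"
    by standard
  have ph: "h (fst (p m)) (snd (p m)) = m" for m
  proof -
    obtain a b where "m = h a b"
      using surj_pair[of "inv_into UNIV (\<lambda>(a, b). h a b) m"] surj_f_inv_f[OF bij_is_surj[OF h], of m]
      by fastforce
    then show ?thesis by (simp add: fs)
  qed
  fix l u :: "real^'m" assume lu: "\<And>m. l $ m \<le> u $ m"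
  define L where "L a = (\<chi> b. l $ h a b)" for a
  define U where "U a = (\<chi> b. u $ h a b)" for a
  have boxes: "(\<lambda>f. \<chi> m. f (fst (p m)) $ snd (p m)) -` box l u
      \<inter> space (Pi\<^sub>M UNIV (\<lambda>_::'a. lborel :: (real^'b) measure)) = (\<Pi>\<^sub>E a\<in>UNIV. box (L a) (U a))"
  proof -
    have "(\<forall>m. l $ m < f (fst (p m)) $ snd (p m) \<and> f (fst (p m)) $ snd (p m) < u $ m) \<longleftrightarrow>
        (\<forall>a b. l $ h a b < f a $ b \<and> f a $ b < u $ h a b)" for f :: "'a \<Rightarrow> real^'b"
    proof (intro iffI allI)
      fix a b assume "\<forall>m. l $ m < f (fst (p m)) $ snd (p m) \<and> f (fst (p m)) $ snd (p m) < u $ m"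
      from this[rule_format, of "h a b"] show "l $ h a b < f a $ b \<and> f a $ b < u $ h a b"
        by (simp add: fs)
    next
      fix m assume "\<forall>a b. l $ h a b < f a $ b \<and> f a $ b < u $ h a b"
      from this[rule_format, of "fst (p m)" "snd (p m)"]
      show "l $ m < f (fst (p m)) $ snd (p m) \<and> f (fst (p m)) $ snd (p m) < u $ m"
        by (simp add: ph)
    qed
    then show ?thesis
      by (auto simp: space_PiM PiE_iff mem_box_cart L_def U_def)
  qed
  have "emeasure (distr (Pi\<^sub>M UNIV (\<lambda>_::'a. lborel :: (real^'b) measure)) borel (\<lambda>f. \<chi> m. f (fst (p m)) $ snd (p m))) (box l u)
      = emeasure (Pi\<^sub>M UNIV (\<lambda>_::'a. lborel :: (real^'b) measure)) (\<Pi>\<^sub>E a\<in>UNIV. box (L a) (U a))"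
    by (subst emeasure_distr) (auto simp: boxes)
  also have "\<dots> = (\<Prod>a\<in>UNIV. emeasure lborel (box (L a) (U a)))"
    by (subst emeasure_PiM) auto
  also have "\<dots> = (\<Prod>a\<in>UNIV. ennreal (\<Prod>b\<in>UNIV. u $ h a b - l $ h a b))"
    by (simp add: emeasure_lborel_box_cart lu L_def U_def)
  also have "\<dots> = ennreal (\<Prod>a\<in>UNIV. \<Prod>b\<in>UNIV. u $ h a b - l $ h a b)"
    by (intro prod_ennreal prod_nonneg) (auto simp: lu)
  also have "(\<Prod>a\<in>UNIV. \<Prod>b\<in>UNIV. u $ h a b - l $ h a b) = (\<Prod>x\<in>UNIV. u $ (case x of (a, b) \<Rightarrow> h a b) - l $ (case x of (a, b) \<Rightarrow> h a b))"
    by (simp add: prod.cartesian_product case_prod_unfold)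
  also have "\<dots> = (\<Prod>m\<in>UNIV. u $ m - l $ m)"
    using h by (rule prod.reindex_bij_betw)
  finally show "emeasure (distr (Pi\<^sub>M UNIV (\<lambda>_::'a. lborel :: (real^'b) measure)) borel (\<lambda>f. \<chi> m. f (fst (p m)) $ snd (p m))) (box l u)
      = ennreal (\<Prod>m\<in>UNIV. u $ m - l $ m)" .
qed simp

lemma nn_integral_blocks:
  fixes h :: "'a::finite \<Rightarrow> 'b::finite \<Rightarrow> 'm::finite" and g :: "'a \<Rightarrow> real^'b \<Rightarrow> ennreal"
  assumes h: "bij (\<lambda>(a, b). h a b)" and g[measurable]: "\<And>a. g a \<in> borel_measurable borel"
  shows "(\<integral>\<^sup>+x. (\<Prod>a\<in>UNIV. g a (\<chi> b. x $ h a b)) \<partial>lborel) = (\<Prod>a\<in>UNIV. \<integral>\<^sup>+x. g a x \<partial>lborel)"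
proof -
  interpret product_sigma_finite "\<lambda>_::'a. lborel :: (real^'b) measure"
    by standard
  define p where "p = inv_into UNIV (\<lambda>(a, b). h a b)"
  have p: "p (h a b) = (a, b)" for a b
    using inv_f_f[OF bij_is_inj[OF h], of "(a, b)"] by (simp add: p_def)
  have "(\<integral>\<^sup>+x. (\<Prod>a\<in>UNIV. g a (\<chi> b. x $ h a b)) \<partial>lborel)
      = (\<integral>\<^sup>+f. (\<Prod>a\<in>UNIV. g a (f a)) \<partial>Pi\<^sub>M UNIV (\<lambda>_::'a. lborel :: (real^'b) measure))"
    by (subst lborel_blocks[OF h, of p]) (simp_all add: nn_integral_distr p)
  also have "\<dots> = (\<Prod>a\<in>UNIV. \<integral>\<^sup>+x. g a x \<partial>lborel)"
    by (rule product_nn_integral_prod) auto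
  finally show ?thesis .
qed

section \<open>Volume under linear maps and determinants of block matrices\<close>

text \<open>Integrate over coordinate \<open>m\<close> innermost. With the other coordinates fixed,
  the shear only translates this one by \<open>c\<close> times coordinate \<open>n\<close>, and
  one-dimensional Lebesgue measure is translation invariant.\<close>

lemma emeasure_shear_vimage:
  fixes S :: "(real^'m) set"
  assumes [measurable]: "S \<in> sets borel" and "m \<noteq> n"
  shows "emeasure lborel {x. (\<chi> i. if i = m then x $ m + c * x $ n else x $ i) \<in> S} = emeasure lborel S"
proof -
  interpret product_sigma_finite "\<lambda>_::'m. lborel :: real measure"
    by standard
  have U: "insert m (UNIV - {m}) = (UNIV :: 'm set)"
    by auto
  have peel: "(\<integral>\<^sup>+x. g x \<partial>(lborel :: (real^'m) measure))
      = (\<integral>\<^sup>+f. \<integral>\<^sup>+y. g (\<chi> i. (f(m := y)) i) \<partial>lborel \<partial>Pi\<^sub>M (UNIV - {m}) (\<lambda>_. lborel))"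
    if [measurable]: "g \<in> borel_measurable borel" for g :: "real^'m \<Rightarrow> ennreal"
  proof -
    have "(\<integral>\<^sup>+x. g x \<partial>(lborel :: (real^'m) measure)) = (\<integral>\<^sup>+f. g (\<chi> i. f i) \<partial>Pi\<^sub>M (insert m (UNIV - {m})) (\<lambda>_. lborel))"
      unfolding U by (subst lborel_cart_PiM) (simp add: nn_integral_distr)
    also have "\<dots> = (\<integral>\<^sup>+f. \<integral>\<^sup>+y. g (\<chi> i. (f(m := y)) i) \<partial>lborel \<partial>Pi\<^sub>M (UNIV - {m}) (\<lambda>_. lborel))"
      by (rule product_nn_integral_insert) (auto simp: U)
    finally show ?thesis .
  qed
  have "emeasure lborel {x. (\<chi> i. if i = m then x $ m + c * x $ n else x $ i) \<in> S}
      = (\<integral>\<^sup>+x. indicator {x. (\<chi> i. if i = m then x $ m + c * x $ n else x $ i) \<in> S} x \<partial>lborel)"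
    by (rule nn_integral_indicator[symmetric]) measurable
  also have "\<dots> = (\<integral>\<^sup>+x. indicator S (\<chi> i. if i = m then x $ m + c * x $ n else x $ i) \<partial>lborel)"
    by (rule nn_integral_cong) (simp add: indicator_def)
  also have "\<dots> = (\<integral>\<^sup>+f. \<integral>\<^sup>+y. indicator S (\<chi> i. (f(m := c * f n + 1 * y)) i) \<partial>lborel \<partial>Pi\<^sub>M (UNIV - {m}) (\<lambda>_. lborel))"
    using \<open>m \<noteq> n\<close>
    by (subst peel) (auto intro!: nn_integral_cong arg_cong[where f = "indicator S"] simp: vec_eq_iff)
  also have "\<dots> = (\<integral>\<^sup>+f. \<integral>\<^sup>+y. indicator S (\<chi> i. (f(m := y)) i) \<partial>lborel \<partial>Pi\<^sub>M (UNIV - {m}) (\<lambda>_. lborel))"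
  proof (rule nn_integral_cong)
    fix f :: "'m \<Rightarrow> real"
    have "(\<lambda>y. \<chi> i. (f(m := y)) i) \<in> borel_measurable borel"
    proof (rule borel_measurable_vec_lambda)
      show "(\<lambda>y. (f(m := y)) i) \<in> borel_measurable borel" for i
        by (cases "i = m") auto
    qed
    then have [measurable]: "(\<lambda>y. indicator S (\<chi> i. (f(m := y)) i) :: ennreal) \<in> borel_measurable borel"
      by measurable
    show "(\<integral>\<^sup>+y. indicator S (\<chi> i. (f(m := c * f n + 1 * y)) i) \<partial>lborel) = (\<integral>\<^sup>+y. indicator S (\<chi> i. (f(m := y)) i) \<partial>lborel)"
      by (subst (2) nn_integral_real_affine[where c = 1 and t = "c * f n"]) auto
  qed
  also have "\<dots> = emeasure lborel S"
    by (subst peel[symmetric]) auto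
  finally show ?thesis .
qed

text \<open>The library's change of variables for linear maps needs a well-ordered index type; the
  version below only needs a finite one.\<close>

lemma emeasure_linear_vimage:
  fixes A :: "real^'m^'m" and S :: "(real^'m) set"
  assumes "det A \<noteq> 0" and "S \<in> sets borel"
  shows "ennreal \<bar>det A\<bar> * emeasure lborel {x. A *v x \<in> S} = emeasure lborel S"
proof -
  \<comment> \<open>The induction decomposes \<open>A\<close> into elementary matrices. The set
    stays quantified because the product case uses the hypothesis for \<open>B\<close> at the
    preimage of \<open>S\<close> under \<open>A\<close>; the condition on the determinant stays
    inside because it disposes of the case of a zero row.\<close>
  have "det A \<noteq> 0 \<longrightarrow> (\<forall>S\<in>sets borel. ennreal \<bar>det A\<bar> * emeasure lborel {x. A *v x \<in> S} = emeasure lborel S)"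
  proof (induction A rule: induct_matrix_elementary)
    case (1 A B)
    show ?case
    proof (intro impI ballI)
      fix S :: "(real^'m) set" assume nz: "det (A ** B) \<noteq> 0" and [measurable]: "S \<in> sets borel"
      have "ennreal \<bar>det (A ** B)\<bar> * emeasure lborel {x. (A ** B) *v x \<in> S}
          = ennreal \<bar>det A\<bar> * (ennreal \<bar>det B\<bar> * emeasure lborel {x. B *v x \<in> {x. A *v x \<in> S}})"
        by (simp add: det_mul abs_mult ennreal_mult mult.assoc matrix_vector_mul_assoc)
      also have "\<dots> = ennreal \<bar>det A\<bar> * emeasure lborel {x. A *v x \<in> S}"
        using 1(2)[THEN mp, THEN bspec, of "{x. A *v x \<in> S}"] nz by (simp add: det_mul)
      also have "\<dots> = emeasure lborel S"
        using 1(1) nz by (auto simp: det_mul)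
      finally show "ennreal \<bar>det (A ** B)\<bar> * emeasure lborel {x. (A ** B) *v x \<in> S} = emeasure lborel S" .
    qed
  next
    case (2 A i)
    then show ?case
      by (simp add: det_zero_row)
  next
    case (3 A)
    have comp: "(A *v x) $ i = A $ i $ i * x $ i" for x i
      using 3 by (simp add: matrix_vector_mult_def sum.remove[of UNIV i])
    have Av: "A *v x = 0 + (\<Sum>j\<in>Basis. ((A *v j) \<bullet> j * (x \<bullet> j)) *\<^sub>R j)" for x
    proof -
      have "(A *v x) \<bullet> axis i 1 = (A *v axis i 1) \<bullet> axis i 1 * (x \<bullet> axis i 1)" for i
        by (simp add: comp flip: cart_eq_inner_axis)
      then have "(A *v x) \<bullet> b = (A *v b) \<bullet> b * (x \<bullet> b)" if "b \<in> Basis" for b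
        using that by (auto simp: Basis_vec_def)
      then show ?thesis
        by (subst euclidean_representation[of "A *v x", symmetric]) simp
    qed
    have diag: "(A *v axis i 1) \<bullet> axis i 1 = A $ i $ i" for i
      by (simp add: comp flip: cart_eq_inner_axis)
    have dA: "det A = (\<Prod>i\<in>UNIV. A $ i $ i)"
      using 3 by (intro det_diagonal) auto
    show ?case
    proof (intro impI ballI)
      fix S :: "(real^'m) set" assume nz: "det A \<noteq> 0" and [measurable]: "S \<in> sets borel"
      have "lborel = density (distr lborel borel (\<lambda>x. A *v x)) (\<lambda>_. \<Prod>j\<in>Basis. \<bar>(A *v j) \<bullet> j\<bar>)"
      proof -
        have "(A *v b) \<bullet> b \<noteq> 0" if "b \<in> Basis" for b
          using that nz by (auto simp: Basis_vec_def diag dA)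
        from lborel_affine_euclidean[of "\<lambda>j. (A *v j) \<bullet> j", OF this, of 0] show ?thesis
          by (simp only: Av[symmetric])
      qed
      also have "(\<Prod>j\<in>Basis. \<bar>(A *v j) \<bullet> j\<bar>) = \<bar>det A\<bar>"
        by (simp add: prod_Basis_cart diag dA abs_prod)
      finally have "emeasure lborel S = emeasure (density (distr lborel borel (\<lambda>x. A *v x)) (\<lambda>_. ennreal \<bar>det A\<bar>)) S"
        by simp
      also have "\<dots> = ennreal \<bar>det A\<bar> * emeasure lborel {x. A *v x \<in> S}"
        by (subst emeasure_density_const) (auto simp: emeasure_distr vimage_def)
      finally show "ennreal \<bar>det A\<bar> * emeasure lborel {x. A *v x \<in> S} = emeasure lborel S" ..
    qed
  next
    case (4 m n)
    let ?\<tau> = "Transposition.transpose m n"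
    let ?A = "(\<chi> i j. mat 1 $ i $ ?\<tau> j) :: real^'m^'m"
    have dA: "\<bar>det ?A\<bar> = 1"
      by (simp add: det_permute_columns permutes_swap_id sign_swap_id abs_mult)
    have Av: "?A *v x = (\<chi> i. x $ ?\<tau> i)" for x
    proof -
      have "(\<Sum>j\<in>UNIV. (if i = ?\<tau> j then 1 else 0) * x $ j) = (\<Sum>j\<in>UNIV. if j = ?\<tau> i then x $ j else 0)" for i
        by (intro sum.cong) auto
      then show ?thesis
        by (simp add: matrix_vector_mult_def mat_def vec_eq_iff)
    qed
    have "(lborel :: (real^'m) measure) = distr lborel borel (\<lambda>x. \<chi> i. x $ ?\<tau> i)"
    proof (rule lborel_cart_eqI)
      fix l u :: "real^'m" assume lu: "\<And>i. l $ i \<le> u $ i"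
      have all: "(\<forall>i. P (?\<tau> i) i) \<longleftrightarrow> (\<forall>i. P i (?\<tau> i))" for P
        by (metis transpose_involutory)
      have "(\<lambda>x. \<chi> i. x $ ?\<tau> i) -` box l u = box (\<chi> i. l $ ?\<tau> i) (\<chi> i. u $ ?\<tau> i)"
        using all[of "\<lambda>i j. l $ j < x $ i \<and> x $ i < u $ j" for x] by (auto simp: mem_box_cart)
      then have "emeasure (distr lborel borel (\<lambda>x. \<chi> i. x $ ?\<tau> i)) (box l u)
          = ennreal (\<Prod>i\<in>UNIV. u $ ?\<tau> i - l $ ?\<tau> i)"
        by (subst emeasure_distr) (auto simp: emeasure_lborel_box_cart lu)
      also have "(\<Prod>i\<in>UNIV. u $ ?\<tau> i - l $ ?\<tau> i) = (\<Prod>i\<in>UNIV. u $ i - l $ i)"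
        by (rule prod.reindex_bij_betw) (rule bij_transpose)
      finally show "emeasure (distr lborel borel (\<lambda>x. \<chi> i. x $ ?\<tau> i)) (box l u) = ennreal (\<Prod>i\<in>UNIV. u $ i - l $ i)" .
    qed simp
    note lborel_swap = this
    have "emeasure lborel {x. ?A *v x \<in> S} = emeasure lborel S" if [measurable]: "S \<in> sets borel" for S
    proof -
      have "emeasure lborel {x. ?A *v x \<in> S} = emeasure (distr lborel borel (\<lambda>x. \<chi> i. x $ ?\<tau> i)) S"
        by (subst emeasure_distr) (auto simp: Av vimage_def)
      then show ?thesis
        by (simp only: lborel_swap[symmetric])
    qed
    then show ?case
      by (simp add: dA)
  next
    case (5 m n c)
    let ?A = "(\<chi> i j. if i = m \<and> j = n then c else of_bool (i = j)) :: real^'m^'m"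
    have "?A = (\<chi> k. if k = m then row m (mat 1) + c *s row n (mat 1) else row k (mat 1))"
      using \<open>m \<noteq> n\<close> by (auto simp: vec_eq_iff row_def mat_def)
    then have dA: "det ?A = 1"
      using det_row_operation[OF \<open>m \<noteq> n\<close>, of "mat 1 :: real^'m^'m" c] by simp
    have Av: "?A *v x = (\<chi> i. if i = m then x $ m + c * x $ n else x $ i)" for x
    proof -
      have "(\<Sum>j\<in>UNIV. (if m = m \<and> j = n then c else of_bool (m = j)) * x $ j)
          = (\<Sum>j\<in>UNIV. (if j = n then c * x $ j else 0) + (if j = m then x $ j else 0))"
        using \<open>m \<noteq> n\<close> by (intro sum.cong) auto
      also have "\<dots> = x $ m + c * x $ n"
        by (simp add: sum.distrib)
      finally have m: "(\<Sum>j\<in>UNIV. (if m = m \<and> j = n then c else of_bool (m = j)) * x $ j) = x $ m + c * x $ n" .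
      have "(\<Sum>j\<in>UNIV. (if i = m \<and> j = n then c else of_bool (i = j)) * x $ j)
          = (\<Sum>j\<in>UNIV. if j = i then x $ j else 0)" if "i \<noteq> m" for i
        using that by (intro sum.cong) auto
      with m show ?thesis
        by (auto simp: matrix_vector_mult_def vec_eq_iff)
    qed
    show ?case
      using \<open>m \<noteq> n\<close> by (simp add: dA Av emeasure_shear_vimage)
  qed
  with assms show ?thesis by blast
qed

lemma det_nonzero_iff_ker:
  fixes A :: "real^'m^'m"
  shows "det A \<noteq> 0 \<longleftrightarrow> (\<forall>x. A *v x = 0 \<longrightarrow> x = 0)"
  using det_nz_iff_inj[of "(*v) A"] linear_injective_0[of "(*v) A"] by simp

text \<open>Both sides are the factor by which the volume of the unit cube is scaled; this avoids expanding the
  determinant over permutations.\<close>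

lemma abs_det_blocks:
  fixes h :: "'a::finite \<Rightarrow> 'b::finite \<Rightarrow> 'm::finite" and A :: "real^'m^'m" and B :: "'a \<Rightarrow> real^'b^'b"
  assumes h: "bij (\<lambda>(a, b). h a b)"
    and A: "\<And>a b a' b'. A $ h a b $ h a' b' = (if a = a' then B a $ b $ b' else 0)"
    and nzB: "\<And>a. det (B a) \<noteq> 0"
  shows "det A \<noteq> 0" and "\<bar>det A\<bar> = (\<Prod>a\<in>UNIV. \<bar>det (B a)\<bar>)"
proof -
  define C :: "(real^'b) set" where "C = cbox 0 (\<chi> i. 1)"
  define D :: "(real^'m) set" where "D = cbox 0 (\<chi> i. 1)"
  have ex_h: "\<exists>a b. m = h a b" for m
    using surj_pair[of "inv_into UNIV (\<lambda>(a, b). h a b) m"] surj_f_inv_f[OF bij_is_surj[OF h], of m]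
    by fastforce
  have D_iff: "y \<in> D \<longleftrightarrow> (\<forall>a. (\<chi> b. y $ h a b) \<in> C)" for y
  proof -
    have "(\<forall>m. P m) \<longleftrightarrow> (\<forall>a b. P (h a b))" for P
      using ex_h by metis
    then show ?thesis
      by (simp add: C_def D_def mem_box_cart)
  qed
  have Av: "(\<chi> b. (A *v x) $ h a b) = B a *v (\<chi> b. x $ h a b)" for x a
  proof (rule vec_eq_iff[THEN iffD2], rule allI)
    fix b
    have "(A *v x) $ h a b = (\<Sum>m\<in>UNIV. A $ h a b $ m * x $ m)"
      by (simp add: matrix_vector_mult_def)
    also have "\<dots> = (\<Sum>y\<in>UNIV. A $ h a b $ (case y of (a, b) \<Rightarrow> h a b) * x $ (case y of (a, b) \<Rightarrow> h a b))"
      using h by (rule sum.reindex_bij_betw[symmetric])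
    also have "\<dots> = (\<Sum>a'\<in>UNIV. \<Sum>b'\<in>UNIV. A $ h a b $ h a' b' * x $ h a' b')"
      by (simp add: sum.cartesian_product case_prod_unfold)
    also have "\<dots> = (\<Sum>a'\<in>UNIV. if a' = a then \<Sum>b'\<in>UNIV. B a $ b $ b' * x $ h a b' else 0)"
      by (intro sum.cong refl) (simp add: A)
    also have "\<dots> = (B a *v (\<chi> b. x $ h a b)) $ b"
      by (simp add: matrix_vector_mult_def)
    finally show "(\<chi> b. (A *v x) $ h a b) $ b = (B a *v (\<chi> b. x $ h a b)) $ b"
      by simp
  qed
  show "det A \<noteq> 0"
    unfolding det_nonzero_iff_ker
  proof (intro allI impI)
    fix x assume "A *v x = 0"
    then have "B a *v (\<chi> b. x $ h a b) = 0" for a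
      using Av[of x a] by (simp add: vec_eq_iff)
    then have "(\<chi> b. x $ h a b) = 0" for a
      using nzB[of a] unfolding det_nonzero_iff_ker by blast
    then have "x $ h a b = 0" for a b
      by (simp add: vec_eq_iff)
    then show "x = 0"
      using ex_h by (metis vec_eq_iff zero_index)
  qed
  note nz = this nzB
  have [measurable]: "C \<in> sets borel" "D \<in> sets borel"
    by (auto simp: C_def D_def)
  have CD: "emeasure lborel C = 1" "emeasure lborel D = 1"
    by (auto simp: C_def D_def emeasure_unit_cube_cart)
  have "emeasure lborel {x. A *v x \<in> D}
      = (\<integral>\<^sup>+x. (\<Prod>a\<in>UNIV. indicator {x. B a *v x \<in> C} (\<chi> b. x $ h a b)) \<partial>lborel)"
  proof -
    have "indicator {x. A *v x \<in> D} x = (\<Prod>a\<in>UNIV. indicator {x. B a *v x \<in> C} (\<chi> b. x $ h a b) :: ennreal)" for x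
    proof (cases "A *v x \<in> D")
      case True
      then show ?thesis by (simp add: D_iff Av)
    next
      case False
      then obtain a where "B a *v (\<chi> b. x $ h a b) \<notin> C"
        by (auto simp: D_iff Av)
      then have "(\<Prod>a\<in>UNIV. indicator {x. B a *v x \<in> C} (\<chi> b. x $ h a b) :: ennreal) = 0"
        by (intro prod_zero bexI[of _ a]) auto
      with False show ?thesis by simp
    qed
    then show ?thesis
      by (simp flip: nn_integral_indicator)
  qed
  also have "\<dots> = (\<Prod>a\<in>UNIV. \<integral>\<^sup>+x. indicator {x. B a *v x \<in> C} x \<partial>lborel)"
    by (rule nn_integral_blocks[OF h]) measurable
  also have "\<dots> = (\<Prod>a\<in>UNIV. emeasure lborel {x. B a *v x \<in> C})"
    by (subst nn_integral_indicator) auto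
  finally have eq: "emeasure lborel {x. A *v x \<in> D} = \<dots>" .
  \<comment> \<open>Every factor inserted here equals 1, the volume of the cube \<open>C\<close>.
    After regrouping, \<open>det A\<close> is absorbed by the volume of the preimage of
    \<open>D\<close>, so no division in the extended reals occurs.\<close>
  have "ennreal \<bar>det A\<bar> = ennreal \<bar>det A\<bar> * (\<Prod>a\<in>UNIV. ennreal \<bar>det (B a)\<bar> * emeasure lborel {x. B a *v x \<in> C})"
    by (subst emeasure_linear_vimage) (use nz CD in auto)
  also have "\<dots> = (\<Prod>a\<in>UNIV. ennreal \<bar>det (B a)\<bar>) * (ennreal \<bar>det A\<bar> * emeasure lborel {x. A *v x \<in> D})"
    by (simp add: eq prod.distrib mult_ac)
  also have "\<dots> = (\<Prod>a\<in>UNIV. ennreal \<bar>det (B a)\<bar>)"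
    by (subst emeasure_linear_vimage) (use nz CD in auto)
  also have "\<dots> = ennreal (\<Prod>a\<in>UNIV. \<bar>det (B a)\<bar>)"
    by (rule prod_ennreal) auto
  finally show "\<bar>det A\<bar> = (\<Prod>a\<in>UNIV. \<bar>det (B a)\<bar>)"
    by (simp add: prod_nonneg)
qed

text \<open>The integral of exp(-g), for g the sum of the block norms, is evaluated twice: by
  homogeneity it is a factorial times the volume sought, and by Tonelli it is a power of the same
  integral over one block, where the unit ball is known. For blocks of length 4 the base is 4!
  \<pi>^2 / 2 = 12 \<pi>^2.\<close>

lemma emeasure_sum_norm_blocks:
  "emeasure lborel {x :: real^('n::finite \<times> 'b::finite). (\<Sum>s\<in>UNIV. norm (\<chi> j. x $ (s, j))) < 1}
     = ennreal ((fact CARD('b) * unit_ball_vol CARD('b)) ^ CARD('n) / fact (CARD('n) * CARD('b)))"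
proof -
  let ?g = "\<lambda>x :: real^('n \<times> 'b). \<Sum>s\<in>UNIV. norm (\<chi> j. x $ (s, j))"
  let ?E = "emeasure lborel {x. ?g x < 1}"
  have [measurable]: "?g \<in> borel_measurable borel"
    by (intro borel_measurable_continuous_onI continuous_intros)
  have hom: "?g (c *\<^sub>R x) = c * ?g x" if "c > 0" for c x
  proof -
    have "(\<chi> j. (c *\<^sub>R x) $ (s, j)) = c *\<^sub>R (\<chi> j. x $ (s, j))" for s
      by (simp add: vec_eq_iff)
    with that show ?thesis
      by (simp add: sum_distrib_left)
  qed
  have "ennreal (fact (CARD('n) * CARD('b))) * ?E = (\<integral>\<^sup>+x. ennreal (exp (- ?g x)) \<partial>lborel)"
    by (subst nn_integral_exp_homogeneous) (use hom in \<open>auto intro!: sum_nonneg\<close>)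
  also have "\<dots> = (\<integral>\<^sup>+x. (\<Prod>s\<in>UNIV. ennreal (exp (- norm (\<chi> j. (x :: real^('n \<times> 'b)) $ (s, j))))) \<partial>lborel)"
    by (rule nn_integral_cong) (simp add: prod_ennreal exp_sum flip: sum_negf)
  also have "\<dots> = (\<Prod>s\<in>(UNIV :: 'n set). \<integral>\<^sup>+x. ennreal (exp (- norm (x :: real^'b))) \<partial>lborel)"
    by (rule nn_integral_blocks[where h = Pair]) auto
  also have "(\<integral>\<^sup>+x. ennreal (exp (- norm (x :: real^'b))) \<partial>lborel) = ennreal (fact CARD('b) * unit_ball_vol CARD('b))"
  proof -
    have "emeasure lborel {x :: real^'b. norm x < 1} = ennreal (unit_ball_vol CARD('b))"
      using emeasure_ball[of 1 "0 :: real^'b"] by (simp add: ball_def dist_norm)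
    then show ?thesis
      by (subst nn_integral_exp_homogeneous) (auto simp: ennreal_mult)
  qed
  finally have *: "ennreal (fact (CARD('n) * CARD('b))) * ?E = ennreal ((fact CARD('b) * unit_ball_vol CARD('b)) ^ CARD('n))"
    by (simp add: ennreal_power)
  have "?E = ennreal (1 / fact (CARD('n) * CARD('b))) * (ennreal (fact (CARD('n) * CARD('b))) * ?E)"
    by (simp add: mult.assoc[symmetric] flip: ennreal_mult)
  also have "\<dots> = ennreal ((fact CARD('b) * unit_ball_vol CARD('b)) ^ CARD('n) / fact (CARD('n) * CARD('b)))"
    unfolding * by (simp flip: ennreal_mult)
  finally show ?thesis .
qed

section \<open>Algebraic integers\<close>

text \<open>\<open>y\<close> is an eigenvalue of an integer matrix and hence a root of its
  characteristic polynomial \<open>P\<close>, written out as a sum over permutations. Only the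
  identity attains the full degree, since any other permutation misses a diagonal entry; so
  \<open>P\<close> is monic.\<close>

lemma algebraic_int_eigenvalue:
  fixes M :: "'n::finite \<Rightarrow> 'n \<Rightarrow> int" and v :: "'n \<Rightarrow> real"
  assumes eig: "\<And>t. y * v t = (\<Sum>u\<in>UNIV. of_int (M t u) * v u)" and nz: "v t0 \<noteq> 0"
  shows "algebraic_int y"
proof -
  define A :: "'n \<Rightarrow> 'n \<Rightarrow> real poly" where "A t u = [:- of_int (M t u), if t = u then 1 else 0:]" for t u
  define Q where "Q p = of_int (sign p) * (\<Prod>t\<in>UNIV. A t (p t))" for p
  define P where "P = (\<Sum>p | p permutes UNIV. Q p)"
  have int_mult: "\<forall>i. Polynomial.coeff (p * q) i \<in> \<int>" if "\<forall>i. Polynomial.coeff p i \<in> \<int>" "\<forall>i. Polynomial.coeff q i \<in> \<int>" for p q :: "real poly"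
    using that by (auto simp: coeff_mult)
  have int_A: "\<forall>i. Polynomial.coeff (A t u) i \<in> \<int>" for t u
    by (auto simp: A_def coeff_pCons split: nat.split)
  have int_prod: "\<forall>i. Polynomial.coeff (\<Prod>t\<in>I. A t (p t)) i \<in> \<int>" if "finite I" for I p
    using that
  proof induction
    case empty
    then show ?case by (simp add: coeff_1)
  next
    case (insert x F)
    then show ?case
      using int_mult[OF int_A insert.IH] by simp
  qed
  have "Polynomial.coeff (Q p) i \<in> \<int>" for p i
    using int_prod[of UNIV p] by (simp add: Q_def of_int_poly)
  then have int_P: "\<forall>i. Polynomial.coeff P i \<in> \<int>"
    by (auto simp: P_def coeff_sum)
  have deg_A: "Polynomial.degree (A t u) \<le> (if t = u then 1 else 0)" for t u
    by (auto simp: A_def)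
  have deg_Q: "Polynomial.degree (Q p) < CARD('n)" if p: "p \<noteq> id" for p
  proof -
    obtain t where t: "p t \<noteq> t"
      using p by (auto simp: fun_eq_iff)
    have "Polynomial.degree (Q p) \<le> Polynomial.degree (\<Prod>t\<in>UNIV. A t (p t))"
      by (simp add: Q_def of_int_poly)
    also have "\<dots> \<le> (\<Sum>t\<in>UNIV. Polynomial.degree (A t (p t)))"
      using degree_prod_sum_le[of UNIV "\<lambda>t. A t (p t)"] by (simp add: o_def)
    also have "\<dots> \<le> (\<Sum>u\<in>UNIV. if u = p u then 1 else 0)"
      using deg_A by (intro sum_mono) metis
    also have "\<dots> < (\<Sum>u\<in>(UNIV :: 'n set). 1)"
      using t by (intro sum_strict_mono_ex1 bexI[of _ t]) auto
    finally show ?thesis by simp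
  qed
  have A_diag: "Polynomial.degree (A t t) = 1" "Polynomial.lead_coeff (A t t) = 1" for t
    by (auto simp: A_def)
  then have "A t t \<noteq> 0" for t
    by (metis degree_0 zero_neq_one)
  then have deg_id: "Polynomial.degree (Q id) = CARD('n)"
    by (simp add: Q_def degree_prod_eq_sum_degree A_diag)
  have lead_id: "Polynomial.lead_coeff (Q id) = 1"
    using lead_coeff_prod[of "\<lambda>t. A t t" UNIV] by (simp add: Q_def A_diag(2) del: One_nat_def)
  have P_split: "P = (\<Sum>p \<in> {p. p permutes UNIV} - {id}. Q p) + Q id"
    unfolding P_def by (subst sum.remove[of _ id]) (auto simp: permutes_id finite_permutations add.commute)
  have "Polynomial.degree (\<Sum>p \<in> {p. p permutes (UNIV :: 'n set)} - {id}. Q p) < CARD('n)"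
    by (intro degree_sum_less) (use deg_Q in auto)
  then have "Polynomial.lead_coeff P = 1"
    unfolding P_split using deg_id lead_id by (subst lead_coeff_add_le) auto
  moreover have "poly P y = 0"
  proof -
    define B :: "real^'n^'n" where "B = (\<chi> t u. (if t = u then y else 0) - of_int (M t u))"
    have "poly (A t u) y = B $ t $ u" for t u
      by (simp add: A_def B_def)
    then have "poly P y = det B"
      by (simp add: P_def Q_def det_def poly_sum poly_prod of_int_poly)
    moreover have "B *v (\<chi> t. v t) = 0"
    proof -
      have "(\<Sum>u\<in>UNIV. ((if t = u then y else 0) - of_int (M t u)) * v u)
          = (\<Sum>u\<in>UNIV. if u = t then y * v u else 0) - (\<Sum>u\<in>UNIV. of_int (M t u) * v u)" for t
        unfolding sum_subtractf[symmetric] by (intro sum.cong) (auto simp: left_diff_distrib)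
      then show ?thesis
        by (simp add: vec_eq_iff B_def matrix_vector_mult_def eig[symmetric])
    qed
    moreover have "(\<chi> t. v t) \<noteq> 0"
      using nz by (auto simp: vec_eq_iff)
    ultimately show ?thesis
      using det_nonzero_iff_ker[of B] by auto
  qed
  ultimately show ?thesis
    using int_P by (intro algebraic_int.intros)
qed

lemma common_denominator:
  fixes f :: "'i \<Rightarrow> real"
  assumes "finite I" and "\<And>i. i \<in> I \<Longrightarrow> f i \<in> \<rat>"
  shows "\<exists>q::nat. q > 0 \<and> (\<forall>i\<in>I. of_nat q * f i \<in> \<int>)"
  using assms
proof (induction I)
  case empty
  show ?case by (auto intro: exI[of _ 1])
next
  case (insert i I)
  then obtain q where q: "q > 0" "\<forall>i\<in>I. of_nat q * f i \<in> \<int>"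
    by auto
  obtain a b where ab: "b > 0" "f i = of_int a / of_int b"
    using insert.prems[of i] by (auto elim: Rats_cases')
  define q' where "q' = nat b * q"
  have "of_nat q' * f i = of_int (a * int q)"
    using ab by (simp add: q'_def)
  then have "of_nat q' * f i \<in> \<int>"
    by (metis Ints_of_int)
  moreover have "of_nat q' * f j \<in> \<int>" if "j \<in> I" for j
  proof -
    have "of_nat q' * f j = of_nat (nat b) * (of_nat q * f j)"
      by (simp add: q'_def)
    then show ?thesis
      using q that by (metis Ints_mult Ints_of_nat)
  qed
  ultimately show ?case
    using q ab by (intro exI[of _ q']) (auto simp: q'_def)
qed

lemma det_Ints:
  fixes A :: "real^'n^'n"
  assumes "\<And>i j. A $ i $ j \<in> \<int>"
  shows "det A \<in> \<int>"
  unfolding det_def using assms by (intro Ints_sum Ints_mult Ints_prod) auto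

text \<open>A monic integer relation rewrites x^d in lower powers without denominators. The point is
  that \<open>d\<close> serves all exponents at once, so that denominators which are cleared for the
  first \<open>d\<close> powers are cleared for all of them.\<close>

lemma algebraic_int_power_span:
  fixes x :: real
  assumes "algebraic_int x"
  shows "\<exists>d. \<forall>k. \<exists>c :: nat \<Rightarrow> int. x ^ k = (\<Sum>i<d. of_int (c i) * x ^ i)"
proof -
  obtain p :: "int poly" where p: "poly (map_poly of_int p) x = 0" "Polynomial.lead_coeff p = 1"
    using assms by (auto simp: algebraic_int_altdef_ipoly)
  define d where "d = Polynomial.degree p"
  have "p \<noteq> 0" using p(2) by auto
  have "(\<Sum>i\<le>d. of_int (Polynomial.coeff p i) * x ^ i) = 0"
    using p(1) by (simp add: poly_altdef d_def coeff_map_poly degree_map_poly)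
  then have xd: "x ^ d = - (\<Sum>i<d. of_int (Polynomial.coeff p i) * x ^ i)"
    using p(2) by (simp add: lessThan_Suc_atMost[symmetric] d_def)
  have "d > 0"
  proof (rule ccontr)
    assume "\<not> d > 0"
    with xd show False by simp
  qed
  have "\<exists>c :: nat \<Rightarrow> int. x ^ k = (\<Sum>i<d. of_int (c i) * x ^ i)" for k
  proof (induction k)
    case 0
    have "(\<Sum>i<d. of_int (if i = 0 then 1 else 0) * x ^ i) = (\<Sum>i<d. if i = 0 then 1 else 0)"
      by (intro sum.cong) auto
    then show ?case
      using \<open>d > 0\<close> by (intro exI[of _ "\<lambda>i. if i = 0 then 1 else 0"]) simp
  next
    case (Suc k)
    then obtain c where c: "x ^ k = (\<Sum>i<d. of_int (c i) * x ^ i)"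
      by blast
    obtain e where e: "d = Suc e"
      using \<open>d > 0\<close> by (cases d) auto
    \<comment> \<open>Multiplication by \<open>x\<close> shifts the coefficients by one place; the
      overflowing term with coefficient \<open>c e\<close> is returned through the monic
      relation.\<close>
    define c' where "c' i = (if i = 0 then 0 else c (i - 1)) - c e * Polynomial.coeff p i" for i
    have "x ^ Suc k = (\<Sum>i<d. of_int (c i) * x ^ Suc i)"
      by (simp add: c sum_distrib_left mult_ac)
    also have "\<dots> = (\<Sum>i<e. of_int (c i) * x ^ Suc i) + of_int (c e) * x ^ d"
      by (simp add: e)
    also have "(\<Sum>i<e. of_int (c i) * x ^ Suc i) = (\<Sum>i<d. of_int (if i = 0 then 0 else c (i - 1)) * x ^ i)"
      unfolding e sum.lessThan_Suc_shift by simp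
    also have "\<dots> + of_int (c e) * x ^ d = (\<Sum>i<d. of_int (c' i) * x ^ i)"
      by (simp only: xd) (simp add: c'_def sum_subtractf algebra_simps sum_distrib_left)
    finally show ?case by blast
  qed
  then show ?thesis by blast
qed

section \<open>Number fields with a full set of real embeddings\<close>

text \<open>Sets and closure facts replace carrier records here. Combined with the independence of
  the distinct embeddings, \<open>spanning\<close> makes the matrix of conjugates of a generating
  family invertible. By \<open>emb_id\<close> the inclusion is one of the embeddings, so an equation
  in the field may be checked on conjugates.\<close>

locale embedded_number_field =
  fixes K :: "real set" and \<sigma> :: "'n::finite \<Rightarrow> real \<Rightarrow> real"
  assumes one_K: "1 \<in> K"
    and add_K: "\<And>x y. x \<in> K \<Longrightarrow> y \<in> K \<Longrightarrow> x + y \<in> K"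
    and mult_K: "\<And>x y. x \<in> K \<Longrightarrow> y \<in> K \<Longrightarrow> x * y \<in> K"
    and uminus_K: "\<And>x. x \<in> K \<Longrightarrow> - x \<in> K"
    and inverse_K: "\<And>x. x \<in> K \<Longrightarrow> inverse x \<in> K"
    and emb_one: "\<And>s. \<sigma> s 1 = 1"
    and emb_add: "\<And>s x y. x \<in> K \<Longrightarrow> y \<in> K \<Longrightarrow> \<sigma> s (x + y) = \<sigma> s x + \<sigma> s y"
    and emb_mult: "\<And>s x y. x \<in> K \<Longrightarrow> y \<in> K \<Longrightarrow> \<sigma> s (x * y) = \<sigma> s x * \<sigma> s y"
    and emb_distinct: "\<And>s t. s \<noteq> t \<Longrightarrow> \<exists>x\<in>K. \<sigma> s x \<noteq> \<sigma> t x"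
    and emb_id: "\<exists>s. \<forall>x\<in>K. \<sigma> s x = x"
    and spanning: "\<exists>a. (\<forall>t::'n. a t \<in> K) \<and> (\<forall>x\<in>K. \<exists>r. (\<forall>t. r t \<in> \<rat>) \<and> x = (\<Sum>t\<in>UNIV. r t * a t))"
    and add_O: "\<And>x y. x \<in> ring_of_integers K \<Longrightarrow> y \<in> ring_of_integers K \<Longrightarrow> x + y \<in> ring_of_integers K"
    and mult_O: "\<And>x y. x \<in> ring_of_integers K \<Longrightarrow> y \<in> ring_of_integers K \<Longrightarrow> x * y \<in> ring_of_integers K"
begin

abbreviation "O\<^sub>K \<equiv> ring_of_integers K"

text \<open>For an integral basis this is a square root of the discriminant.\<close>

definition emb_det :: "('n \<Rightarrow> real) \<Rightarrow> real" where
  "emb_det b = det (\<chi> s t. \<sigma> s (b t))"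

lemma zero_K: "0 \<in> K"
  using add_K[OF one_K uminus_K[OF one_K]] by simp

lemma diff_K: "x \<in> K \<Longrightarrow> y \<in> K \<Longrightarrow> x - y \<in> K"
  using add_K[of x "- y"] uminus_K by simp

lemma divide_K: "x \<in> K \<Longrightarrow> y \<in> K \<Longrightarrow> x / y \<in> K"
  unfolding divide_inverse by (intro mult_K inverse_K)

lemma power_K: "x \<in> K \<Longrightarrow> x ^ k \<in> K"
  by (induction k) (auto intro: one_K mult_K)

lemma of_nat_K: "of_nat k \<in> K"
  by (induction k) (auto intro: zero_K one_K add_K)

lemma of_int_K: "of_int k \<in> K"
  by (cases k rule: int_cases2) (auto intro: of_nat_K uminus_K)

lemma numeral_K: "numeral k \<in> K"
  using of_nat_K[of "numeral k"] by simp

lemma Rats_K: "r \<in> \<rat> \<Longrightarrow> r \<in> K"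
  by (auto elim!: Rats_cases' intro: divide_K of_int_K)

lemma sum_K: "(\<And>i. i \<in> I \<Longrightarrow> f i \<in> K) \<Longrightarrow> sum f I \<in> K"
  by (induction I rule: infinite_finite_induct) (auto intro: zero_K add_K)

lemmas closed_K = zero_K one_K add_K mult_K uminus_K inverse_K diff_K divide_K power_K
  of_nat_K of_int_K numeral_K

lemma O_K: "x \<in> O\<^sub>K \<Longrightarrow> x \<in> K"
  by (simp add: ring_of_integers_def)

lemma of_int_O: "of_int k \<in> O\<^sub>K"
  by (auto simp: ring_of_integers_def of_int_K int_imp_algebraic_int)

lemma of_nat_O: "of_nat k \<in> O\<^sub>K"
  using of_int_O[of "int k"] by simp

lemma zero_O: "0 \<in> O\<^sub>K" and one_O: "1 \<in> O\<^sub>K"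
  using of_int_O[of 0] of_int_O[of 1] by simp_all

lemma uminus_O: "x \<in> O\<^sub>K \<Longrightarrow> - x \<in> O\<^sub>K"
  using mult_O[OF of_int_O[of "-1"]] by simp

lemma diff_O: "x \<in> O\<^sub>K \<Longrightarrow> y \<in> O\<^sub>K \<Longrightarrow> x - y \<in> O\<^sub>K"
  using add_O[of x "- y"] uminus_O by simp

lemma power_O: "x \<in> O\<^sub>K \<Longrightarrow> x ^ k \<in> O\<^sub>K"
  by (induction k) (auto intro: one_O mult_O)

lemma sum_O: "(\<And>i. i \<in> I \<Longrightarrow> f i \<in> O\<^sub>K) \<Longrightarrow> sum f I \<in> O\<^sub>K"
  by (induction I rule: infinite_finite_induct) (auto intro: zero_O add_O)

lemmas closed_O = zero_O one_O add_O mult_O uminus_O diff_O power_O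

lemma emb_zero: "\<sigma> s 0 = 0"
  using emb_add[of 0 0 s] zero_K by simp

lemma emb_uminus: "x \<in> K \<Longrightarrow> \<sigma> s (- x) = - \<sigma> s x"
  using emb_add[of x "- x" s] uminus_K[of x] by (simp add: emb_zero)

lemma emb_diff: "x \<in> K \<Longrightarrow> y \<in> K \<Longrightarrow> \<sigma> s (x - y) = \<sigma> s x - \<sigma> s y"
  using emb_add[of x "- y" s] uminus_K[of y] by (simp add: emb_uminus)

lemma emb_power: "x \<in> K \<Longrightarrow> \<sigma> s (x ^ k) = \<sigma> s x ^ k"
  by (induction k) (auto simp: emb_one emb_mult power_K)

lemma emb_sum: "(\<And>i. i \<in> I \<Longrightarrow> f i \<in> K) \<Longrightarrow> \<sigma> s (sum f I) = (\<Sum>i\<in>I. \<sigma> s (f i))"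
  by (induction I rule: infinite_finite_induct) (auto simp: emb_zero emb_add sum_K)

lemma emb_of_nat: "\<sigma> s (of_nat k) = of_nat k"
  by (induction k) (auto simp: emb_zero emb_one emb_add of_nat_K one_K)

lemma emb_of_int: "\<sigma> s (of_int k) = of_int k"
  by (cases k rule: int_cases2) (auto simp: emb_of_nat emb_uminus of_nat_K)

lemma emb_numeral: "\<sigma> s (numeral k) = numeral k"
  using emb_of_nat[of s "numeral k"] by simp

lemma emb_inverse: "x \<in> K \<Longrightarrow> \<sigma> s (inverse x) = inverse (\<sigma> s x)"
proof (cases "x = 0")
  case False
  assume "x \<in> K"
  then have "\<sigma> s x * \<sigma> s (inverse x) = 1"
    using False emb_mult[of x "inverse x" s] by (simp add: inverse_K emb_one)
  then show ?thesis
    by (metis inverse_unique)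
qed (simp add: emb_zero)

lemma emb_divide: "x \<in> K \<Longrightarrow> y \<in> K \<Longrightarrow> \<sigma> s (x / y) = \<sigma> s x / \<sigma> s y"
  by (simp add: divide_inverse emb_mult emb_inverse inverse_K)

lemma emb_Rats: "r \<in> \<rat> \<Longrightarrow> \<sigma> s r = r"
  by (auto elim!: Rats_cases' simp: emb_divide of_int_K emb_of_int)

lemma emb_nonzero: "x \<in> K \<Longrightarrow> x \<noteq> 0 \<Longrightarrow> \<sigma> s x \<noteq> 0"
  using emb_mult[of x "inverse x" s] by (auto simp: inverse_K emb_one)

section \<open>Independence of the embeddings and the norm as a determinant\<close>

lemma field_norm_mult: "x \<in> K \<Longrightarrow> y \<in> K \<Longrightarrow> field_norm \<sigma> (x * y) = field_norm \<sigma> x * field_norm \<sigma> y"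
  by (simp add: field_norm_def emb_mult prod.distrib)

lemma field_norm_power: "x \<in> K \<Longrightarrow> field_norm \<sigma> (x ^ k) = field_norm \<sigma> x ^ k"
  by (simp add: field_norm_def emb_power prod_power_distrib)

lemma field_norm_nonzero: "x \<in> K \<Longrightarrow> x \<noteq> 0 \<Longrightarrow> field_norm \<sigma> x \<noteq> 0"
  by (simp add: field_norm_def emb_nonzero)

text \<open>Evaluate the relation at \<open>y * x\<close> and subtract \<sigma>_t(y) times the
  relation at \<open>x\<close>. The term of \<open>t\<close> disappears and the other coefficients
  are multiplied by \<sigma>_u(y) - \<sigma>_t(y), which is nonzero at the index \<open>s\<close>
  under consideration when \<open>y\<close> separates \<open>s\<close> from
  \<open>t\<close>.\<close>

theorem dedekind_independence:
  assumes "finite I" and "\<And>x. x \<in> K \<Longrightarrow> (\<Sum>s\<in>I. c s * \<sigma> s x) = 0" and "s \<in> I"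
  shows "c s = 0"
  using assms
proof (induction I arbitrary: c s)
  case (insert t I)
  have eq: "c t * \<sigma> t x + (\<Sum>u\<in>I. c u * \<sigma> u x) = 0" if "x \<in> K" for x
    using insert.prems(1)[OF that] insert.hyps by simp
  have I: "c s = 0" if "s \<in> I" for s
  proof -
    obtain y where y: "y \<in> K" "\<sigma> s y \<noteq> \<sigma> t y"
      using emb_distinct[of s t] \<open>s \<in> I\<close> insert.hyps by auto
    have "c s * (\<sigma> s y - \<sigma> t y) = 0"
    proof (rule insert.IH[OF _ that])
      fix x assume x: "x \<in> K"
      have "(\<Sum>u\<in>I. c u * (\<sigma> u y - \<sigma> t y) * \<sigma> u x)
          = (c t * \<sigma> t (y * x) + (\<Sum>u\<in>I. c u * \<sigma> u (y * x))) - \<sigma> t y * (c t * \<sigma> t x + (\<Sum>u\<in>I. c u * \<sigma> u x))"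
        using x y(1) by (simp add: emb_mult algebra_simps sum_subtractf sum_distrib_left)
      also have "\<dots> = 0"
        using eq[OF x] eq[OF mult_K[OF y(1) x]] by simp
      finally show "(\<Sum>u\<in>I. c u * (\<sigma> u y - \<sigma> t y) * \<sigma> u x) = 0" .
    qed
    with y show ?thesis by simp
  qed
  then have "c t = 0"
    using eq[OF one_K] by (simp add: emb_one)
  with I insert.prems(2) show ?case by auto
qed simp

text \<open>A kernel vector of the transposed matrix is a linear relation between the embeddings on
  the family \<open>b\<close>. It extends to the whole field by rational linearity and contradicts
  their independence.\<close>

lemma emb_det_nonzero:
  assumes b: "\<And>t. b t \<in> K" and span: "\<And>x. x \<in> K \<Longrightarrow> \<exists>r. (\<forall>t. r t \<in> \<rat>) \<and> x = (\<Sum>t\<in>UNIV. r t * b t)"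
  shows "emb_det b \<noteq> 0"
proof -
  have "det (transpose (\<chi> s t. \<sigma> s (b t)) :: real^'n^'n) \<noteq> 0"
    unfolding det_nonzero_iff_ker
  proof (intro allI impI)
    fix c :: "real^'n" assume c: "transpose (\<chi> s t. \<sigma> s (b t)) *v c = 0"
    have bt: "(\<Sum>s\<in>UNIV. c $ s * \<sigma> s (b t)) = 0" for t
      using c by (simp add: vec_eq_iff matrix_vector_mult_def transpose_def mult.commute)
    have "c $ s = 0" for s
    proof (rule dedekind_independence[of UNIV])
      fix x assume "x \<in> K"
      then obtain r where r: "\<And>t. r t \<in> \<rat>" "x = (\<Sum>t\<in>UNIV. r t * b t)"
        using span by blast
      have "(\<Sum>s\<in>UNIV. c $ s * \<sigma> s x) = (\<Sum>s\<in>UNIV. \<Sum>t\<in>UNIV. r t * (c $ s * \<sigma> s (b t)))"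
        by (simp add: r emb_sum emb_mult emb_Rats Rats_K b closed_K sum_distrib_left mult_ac)
      also have "\<dots> = (\<Sum>t\<in>UNIV. r t * (\<Sum>s\<in>UNIV. c $ s * \<sigma> s (b t)))"
        by (subst sum.swap) (simp add: sum_distrib_left)
      finally show "(\<Sum>s\<in>UNIV. c $ s * \<sigma> s x) = 0"
        by (simp add: bt)
    qed auto
    then show "c = 0"
      by (simp add: vec_eq_iff)
  qed
  then show ?thesis
    by (simp add: emb_det_def det_transpose)
qed

text \<open>The matrix of conjugates of the family \<open>a\<close> diagonalises multiplication by
  \<open>x\<close>, with the conjugates of \<open>x\<close> as eigenvalues.\<close>

lemma field_norm_eq_det:
  assumes a: "\<And>t. a t \<in> K" "emb_det a \<noteq> 0" and x: "x \<in> K"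
    and m: "\<And>t u. m t u \<in> \<rat>" "\<And>t. x * a t = (\<Sum>u\<in>UNIV. m t u * a u)"
  shows "field_norm \<sigma> x = det (\<chi> t u. m t u)"
proof -
  define A :: "real^'n^'n" where "A = (\<chi> s t. \<sigma> s (a t))"
  define D :: "real^'n^'n" where "D = (\<chi> s t. if s = t then \<sigma> s x else 0)"
  have "\<sigma> s x * \<sigma> s (a t) = (\<Sum>u\<in>UNIV. \<sigma> s (a u) * m t u)" for s t
  proof -
    have "\<sigma> s (x * a t) = \<sigma> s (\<Sum>u\<in>UNIV. m t u * a u)"
      by (simp add: m)
    then show ?thesis
      by (simp add: emb_mult emb_sum x a m(1) mult_K Rats_K emb_Rats mult.commute)
  qed
  then have "D ** A = A ** transpose (\<chi> t u. m t u)"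
    by (simp add: vec_eq_iff matrix_matrix_mult_def transpose_def A_def D_def if_distribR if_distrib cong: if_cong)
  then have "det D * det A = det A * det (\<chi> t u. m t u)"
    by (metis det_mul det_transpose)
  moreover have "det A \<noteq> 0"
    using a(2) by (simp add: A_def emb_det_def)
  moreover have "det D = field_norm \<sigma> x"
    by (subst det_diagonal) (auto simp: D_def field_norm_def)
  ultimately show ?thesis by simp
qed

text \<open>The powers of an algebraic integer have coordinates with bounded denominators, so their norms, if
  nonzero, are bounded away from zero.\<close>

lemma abs_field_norm_ge_1:
  assumes x: "x \<in> O\<^sub>K" "x \<noteq> 0"
  shows "\<bar>field_norm \<sigma> x\<bar> \<ge> 1"
proof (rule ccontr)
  assume "\<not> ?thesis"
  then have small: "\<bar>field_norm \<sigma> x\<bar> < 1" by simp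
  obtain a where a: "\<And>t::'n. a t \<in> K" "\<And>x. x \<in> K \<Longrightarrow> \<exists>r. (\<forall>t. r t \<in> \<rat>) \<and> x = (\<Sum>t\<in>UNIV. r t * a t)"
    using spanning by blast
  have D: "emb_det a \<noteq> 0"
    using a by (rule emb_det_nonzero)
  have xK: "x \<in> K" using x O_K by blast
  obtain d where d: "\<And>k. \<exists>c :: nat \<Rightarrow> int. x ^ k = (\<Sum>i<d. of_int (c i) * x ^ i)"
    using algebraic_int_power_span[of x] x by (auto simp: ring_of_integers_def)
  have "\<exists>r. (\<forall>u. r u \<in> \<rat>) \<and> x ^ i * a t = (\<Sum>u\<in>UNIV. r u * a u)" for i t
    by (rule a(2)) (auto intro: closed_K xK a(1))
  then obtain m where m: "\<And>i t u. m i t u \<in> \<rat>" "\<And>i t. x ^ i * a t = (\<Sum>u\<in>UNIV. m i t u * a u)"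
    by metis
  \<comment> \<open>One \<open>q\<close> clears the matrices of the powers below \<open>d\<close>,
    and integer combinations of these give all powers. Hence q^n N(x)^k is a nonzero integer for
    every k, which is impossible for large k if |N(x)| < 1.\<close>
  obtain q :: nat where q: "q > 0" "\<forall>z\<in>{..<d} \<times> UNIV \<times> UNIV. of_nat q * (case z of (i, t, u) \<Rightarrow> m i t u) \<in> \<int>"
    using common_denominator[of "{..<d} \<times> (UNIV :: 'n set) \<times> (UNIV :: 'n set)" "\<lambda>(i, t, u). m i t u"] m(1)
    by auto
  have lower: "1 \<le> real q ^ CARD('n) * \<bar>field_norm \<sigma> x\<bar> ^ k" for k
  proof -
    obtain c :: "nat \<Rightarrow> int" where c: "x ^ k = (\<Sum>i<d. of_int (c i) * x ^ i)"
      using d by blast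
    define M where "M t u = (\<Sum>i<d. of_int (c i) * m i t u)" for t u
    have "x ^ k * a t = (\<Sum>u\<in>UNIV. M t u * a u)" for t
    proof -
      have "x ^ k * a t = (\<Sum>i<d. \<Sum>u\<in>UNIV. of_int (c i) * m i t u * a u)"
        by (simp add: c sum_distrib_right mult.assoc m(2) sum_distrib_left)
      then show ?thesis
        by (subst (asm) sum.swap) (simp add: M_def sum_distrib_right)
    qed
    then have "field_norm \<sigma> (x ^ k) = det (\<chi> t u. M t u)"
      by (intro field_norm_eq_det[OF a(1) D]) (auto simp: M_def xK power_K intro!: Rats_sum Rats_mult m)
    moreover have "of_nat q ^ CARD('n) * det (\<chi> t u. M t u) = det (\<chi> t. of_nat q *s (\<chi> u. M t u))"
      by (simp add: det_rows_mul)
    moreover have "det (\<chi> t. of_nat q *s (\<chi> u. M t u)) \<in> \<int>"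
    proof (rule det_Ints)
      fix t u
      have "of_nat q * M t u = (\<Sum>i<d. of_int (c i) * (of_nat q * m i t u))"
        by (simp add: M_def sum_distrib_left mult_ac)
      also have "\<dots> \<in> \<int>"
        using q(2) by (intro Ints_sum Ints_mult[OF Ints_of_int]) auto
      finally show "(\<chi> t. of_nat q *s (\<chi> u. M t u)) $ t $ u \<in> \<int>"
        by simp
    qed
    ultimately have "of_nat q ^ CARD('n) * field_norm \<sigma> x ^ k \<in> \<int>"
      by (simp add: field_norm_power xK)
    moreover have "of_nat q ^ CARD('n) * field_norm \<sigma> x ^ k \<noteq> 0"
      using q(1) field_norm_nonzero[OF xK x(2)] by simp
    ultimately have "1 \<le> \<bar>of_nat q ^ CARD('n) * field_norm \<sigma> x ^ k\<bar>"
      by (rule Ints_nonzero_abs_ge1)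
    then show ?thesis
      by (simp add: abs_mult power_abs)
  qed
  have "(\<lambda>k. real q ^ CARD('n) * \<bar>field_norm \<sigma> x\<bar> ^ k) \<longlonglongrightarrow> real q ^ CARD('n) * 0"
    using small by (intro tendsto_mult tendsto_const LIMSEQ_power_zero) auto
  then have "real q ^ CARD('n) * 0 \<ge> 1"
    by (rule LIMSEQ_le_const) (use lower in auto)
  then show False by simp
qed

text \<open>Multiplication by \<open>x\<close> acts on the generating family through a rational
  matrix. Clearing denominators turns \<open>of_nat q * x\<close> into an eigenvalue of an integer
  matrix; the family is a nonzero eigenvector because it generates 1.\<close>

lemma integral_multiple:
  assumes x: "x \<in> K"
  shows "\<exists>q::nat. q > 0 \<and> of_nat q * x \<in> O\<^sub>K"
proof -
  obtain a where a: "\<And>t::'n. a t \<in> K" "\<And>x. x \<in> K \<Longrightarrow> \<exists>r. (\<forall>t. r t \<in> \<rat>) \<and> x = (\<Sum>t\<in>UNIV. r t * a t)"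
    using spanning by blast
  have "\<exists>t. a t \<noteq> 0"
  proof (rule ccontr)
    assume "\<not> ?thesis"
    with a(2)[OF one_K] show False by simp
  qed
  then obtain t0 where t0: "a t0 \<noteq> 0" ..
  have "\<exists>r. (\<forall>u. r u \<in> \<rat>) \<and> x * a t = (\<Sum>u\<in>UNIV. r u * a u)" for t
    by (rule a(2)) (auto intro: closed_K x a(1))
  then obtain m where m: "\<And>t u. m t u \<in> \<rat>" "\<And>t. x * a t = (\<Sum>u\<in>UNIV. m t u * a u)"
    by metis
  obtain q :: nat where q: "q > 0" "\<forall>z\<in>UNIV. of_nat q * (case z of (t, u) \<Rightarrow> m t u) \<in> \<int>"
    using common_denominator[of "UNIV :: ('n \<times> 'n) set" "\<lambda>(t, u). m t u"] m(1) by auto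
  then have "\<exists>k. of_nat q * m t u = of_int k" for t u
    by (auto elim!: Ints_cases)
  then obtain M where M: "\<And>t u. of_nat q * m t u = of_int (M t u)"
    by metis
  have "algebraic_int (of_nat q * x)"
  proof (rule algebraic_int_eigenvalue[of _ a M, OF _ t0])
    show "of_nat q * x * a t = (\<Sum>u\<in>UNIV. of_int (M t u) * a u)" for t
      by (simp add: mult.assoc m(2) sum_distrib_left flip: M)
  qed
  with q(1) x show ?thesis
    by (auto simp: ring_of_integers_def intro!: exI[of _ q] closed_K)
qed

section \<open>Existence of an integral basis\<close>

lemma emb_coordinates:
  assumes "emb_det b \<noteq> 0"
  obtains r where "\<And>s. \<sigma> s x = (\<Sum>t\<in>UNIV. r t * \<sigma> s (b t))"
proof -
  define A :: "real^'n^'n" where "A = (\<chi> s t. \<sigma> s (b t))"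
  obtain B where "A ** B = mat 1"
    using assms by (metis A_def emb_det_def invertible_det_nz invertible_def)
  define r where "r = B *v (\<chi> s. \<sigma> s x)"
  have "A *v r = (\<chi> s. \<sigma> s x)"
    using \<open>A ** B = mat 1\<close> by (simp add: r_def matrix_vector_mul_assoc)
  then have "\<sigma> s x = (\<Sum>t\<in>UNIV. r $ t * \<sigma> s (b t))" for s
    by (simp add: vec_eq_iff matrix_vector_mult_def A_def mult.commute)
  then show ?thesis
    by (rule that)
qed

lemma eq_if_emb_eq:
  assumes "x \<in> K" "y \<in> K" "\<And>s. \<sigma> s x = \<sigma> s y"
  shows "x = y"
  using emb_id assms by metis

lemma abs_prod_less_1:
  fixes f :: "'n \<Rightarrow> real"
  assumes "\<And>s. \<bar>f s\<bar> < 1"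
  shows "\<bar>\<Prod>s\<in>UNIV. f s\<bar> < 1"
proof -
  have "\<bar>\<Prod>s\<in>UNIV. f s\<bar> \<le> (\<Prod>s\<in>(UNIV::'n set). Max (range (\<lambda>s. \<bar>f s\<bar>)))"
    unfolding abs_prod by (intro prod_mono) auto
  also have "\<dots> < 1"
    using assms by (simp add: power_less_one_iff Max_ge_iff)
  finally show ?thesis .
qed

text \<open>By the pigeonhole principle some multiple of \<open>x\<close> differs from the lattice spanned by \<open>b\<close> by an
  integer with all conjugates below 1, which vanishes.\<close>

lemma bounded_index:
  assumes b: "\<And>t. b t \<in> O\<^sub>K" "emb_det b \<noteq> 0"
  shows "\<exists>C::nat. C > 0 \<and> (\<forall>x\<in>O\<^sub>K. \<exists>c :: 'n \<Rightarrow> int. of_nat C * x = (\<Sum>t\<in>UNIV. of_int (c t) * b t))"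
proof -
  \<comment> \<open>\<open>R\<close> bounds the sum of |\<sigma>_s(b_t)| over t for every s. With Q
    > R, coefficients of size at most 1/Q therefore give conjugates below 1.\<close>
  define R where "R = (\<Sum>s\<in>UNIV. \<Sum>t\<in>UNIV. \<bar>\<sigma> s (b t)\<bar>)"
  obtain Q :: nat where Q: "real Q > R"
    using reals_Archimedean2 by blast
  have "R \<ge> 0"
    by (auto simp: R_def intro!: sum_nonneg)
  with Q have "Q > 0" by (cases Q) auto
  define N where "N = Q ^ CARD('n)"
  have "\<exists>k>0. k \<le> N \<and> (\<exists>c :: 'n \<Rightarrow> int. of_nat k * x = (\<Sum>t\<in>UNIV. of_int (c t) * b t))" if x: "x \<in> O\<^sub>K" for x
  proof -
    obtain r where r: "\<And>s. \<sigma> s x = (\<Sum>t\<in>UNIV. r t * \<sigma> s (b t))"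
      using emb_coordinates[OF b(2)] by blast
    \<comment> \<open>The unit cube of fractional parts is divided into Q^n = \<open>N\<close>
      cells, while \<open>k\<close> runs through the N + 1 values from 0 to
      \<open>N\<close>.\<close>
    define cell where "cell k = (\<lambda>t. \<lfloor>of_nat Q * frac (of_nat k * r t)\<rfloor>)" for k :: nat
    have cell: "cell ` {..N} \<subseteq> PiE UNIV (\<lambda>_. {0..<int Q})"
      using \<open>Q > 0\<close> by (auto simp: cell_def PiE_def frac_lt_1 floor_less_iff)
    have "card (PiE (UNIV :: 'n set) (\<lambda>_. {0..<int Q})) < card {..N}"
      by (simp add: card_PiE N_def)
    then have "\<not> inj_on cell {..N}"
      using card_inj_on_le[OF _ cell] by (auto simp: finite_PiE)
    then obtain k l where kl: "k < l" "l \<le> N" "cell k = cell l"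
      unfolding inj_on_def by (metis atMost_iff linorder_neqE_nat)
    define c where "c t = \<lfloor>of_nat l * r t\<rfloor> - \<lfloor>of_nat k * r t\<rfloor>" for t
    define e where "e t = frac (of_nat l * r t) - frac (of_nat k * r t)" for t
    define y where "y = of_nat (l - k) * x - (\<Sum>t\<in>UNIV. of_int (c t) * b t)"
    have yO: "y \<in> O\<^sub>K"
      unfolding y_def by (intro closed_O sum_O of_nat_O of_int_O x b)
    have "\<bar>e t\<bar> * Q \<le> 1" for t
    proof -
      have "\<lfloor>of_nat Q * frac (of_nat k * r t)\<rfloor> = \<lfloor>of_nat Q * frac (of_nat l * r t)\<rfloor>"
        using kl(3) by (simp add: cell_def fun_eq_iff)
      then have "\<bar>of_nat Q * frac (of_nat l * r t) - of_nat Q * frac (of_nat k * r t)\<bar> \<le> 1"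
        by linarith
      then show ?thesis
        by (simp add: e_def abs_mult mult.commute flip: right_diff_distrib)
    qed
    note e_le = this
    have emb_y: "\<sigma> s y = (\<Sum>t\<in>UNIV. e t * \<sigma> s (b t))" for s
    proof -
      have "\<sigma> s y = of_nat (l - k) * \<sigma> s x - (\<Sum>t\<in>UNIV. of_int (c t) * \<sigma> s (b t))"
        by (simp add: y_def emb_diff emb_mult emb_sum emb_of_nat emb_of_int closed_K sum_K O_K[OF x] O_K[OF b(1)])
      also have "\<dots> = (\<Sum>t\<in>UNIV. (of_nat (l - k) * r t - of_int (c t)) * \<sigma> s (b t))"
        by (simp add: r sum_subtractf algebra_simps sum_distrib_left)
      also have "\<dots> = (\<Sum>t\<in>UNIV. e t * \<sigma> s (b t))"
        using kl(1) by (intro sum.cong) (auto simp: c_def e_def frac_def of_nat_diff algebra_simps)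
      finally show ?thesis .
    qed
    have "\<bar>\<sigma> s y\<bar> < 1" for s
    proof -
      have "\<bar>\<sigma> s y\<bar> * Q \<le> (\<Sum>t\<in>UNIV. \<bar>e t * \<sigma> s (b t)\<bar>) * Q"
        unfolding emb_y by (intro mult_right_mono sum_abs) auto
      also have "\<dots> = (\<Sum>t\<in>UNIV. (\<bar>e t\<bar> * Q) * \<bar>\<sigma> s (b t)\<bar>)"
        by (simp add: sum_distrib_right sum_distrib_left abs_mult mult_ac)
      also have "\<dots> \<le> (\<Sum>t\<in>UNIV. 1 * \<bar>\<sigma> s (b t)\<bar>)"
        by (intro sum_mono mult_right_mono e_le) auto
      also have "\<dots> \<le> R"
        unfolding R_def by (simp, rule member_le_sum) (auto intro!: sum_nonneg)
      also have "R < 1 * real Q"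
        using Q by simp
      finally show ?thesis
        by (rule mult_right_less_imp_less) simp
    qed
    then have "\<bar>field_norm \<sigma> y\<bar> < 1"
      unfolding field_norm_def by (rule abs_prod_less_1)
    then have "y = 0"
      using abs_field_norm_ge_1[OF yO] by force
    then show ?thesis
      using kl by (intro exI[of _ "l - k"]) (auto simp: y_def intro!: exI[of _ c])
  qed
  note * = this
  show ?thesis
  \<comment> \<open>The multiplier found above depends on \<open>x\<close> but is at most
    \<open>N\<close>; the factorial is a multiple common to all of them.\<close>
  proof (intro exI[of _ "fact N"] conjI ballI)
    fix x assume "x \<in> O\<^sub>K"
    then obtain k and c :: "'n \<Rightarrow> int" where k: "k > 0" "k \<le> N" "of_nat k * x = (\<Sum>t\<in>UNIV. of_int (c t) * b t)"
      using * by blast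
    then obtain j where j: "fact N = k * j"
      using dvd_fact[of k N] by auto
    have "of_nat (fact N) * x = of_nat j * (of_nat k * x)"
      by (simp add: j del: of_nat_fact)
    also have "\<dots> = (\<Sum>t\<in>UNIV. of_int (int j * c t) * b t)"
      by (simp only: k(3) sum_distrib_left) (simp add: mult_ac)
    finally show "\<exists>c :: 'n \<Rightarrow> int. of_nat (fact N) * x = (\<Sum>t\<in>UNIV. of_int (c t) * b t)"
      by (intro exI[of _ "\<lambda>t. int j * c t"])
  qed simp
qed

text \<open>A family of integers with minimal nonzero \<open>emb_det\<close> works: a non-integral coordinate could be
  replaced by its fractional part, which shrinks the determinant by that factor.\<close>

theorem integral_basis_exists: "\<exists>b :: 'n \<Rightarrow> real. integral_basis K b"
proof -
  obtain a where a: "\<And>t::'n. a t \<in> K" "\<And>x. x \<in> K \<Longrightarrow> \<exists>r. (\<forall>t. r t \<in> \<rat>) \<and> x = (\<Sum>t\<in>UNIV. r t * a t)"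
    using spanning by blast
  have "\<exists>q::nat. q > 0 \<and> of_nat q * a t \<in> O\<^sub>K" for t
    using a(1) by (rule integral_multiple)
  then obtain q :: "'n \<Rightarrow> nat" where q: "\<And>t. q t > 0" "\<And>t. of_nat (q t) * a t \<in> O\<^sub>K"
    by metis
  define b0 where "b0 t = of_nat (q t) * a t" for t
  have b0: "\<And>t. b0 t \<in> O\<^sub>K"
    by (simp add: b0_def q)
  have D0: "emb_det b0 \<noteq> 0"
  proof (rule emb_det_nonzero)
    show "b0 t \<in> K" for t
      using b0 O_K by blast
    fix x assume "x \<in> K"
    then obtain r where r: "\<And>t. r t \<in> \<rat>" "x = (\<Sum>t\<in>UNIV. r t * a t)"
      using a(2) by blast
    have "x = (\<Sum>t\<in>UNIV. (r t / of_nat (q t)) * b0 t)"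
      unfolding r(2) b0_def using q(1) by (intro sum.cong) (auto simp: less_imp_neq[symmetric])
    then show "\<exists>r. (\<forall>t. r t \<in> \<rat>) \<and> x = (\<Sum>t\<in>UNIV. r t * b0 t)"
      using r(1) by (intro exI[of _ "\<lambda>t. r t / of_nat (q t)"]) auto
  qed
  obtain C :: nat where C: "C > 0" "\<And>x. x \<in> O\<^sub>K \<Longrightarrow> \<exists>c :: 'n \<Rightarrow> int. of_nat C * x = (\<Sum>t\<in>UNIV. of_int (c t) * b0 t)"
    using bounded_index[OF b0 D0] by blast
  \<comment> \<open>Each \<open>of_nat C * b t\<close> is an integer combination of
    \<open>b0\<close>. So the determinants in question are integer multiples of one fixed real
    number, and a smallest nonzero absolute value exists; \<open>ix\<close> records the multiple as
    a natural number.\<close>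
  have quot: "of_nat C ^ CARD('n) * emb_det b / emb_det b0 \<in> \<int>" if b: "\<And>t. b t \<in> O\<^sub>K" for b
  proof -
    obtain c :: "'n \<Rightarrow> 'n \<Rightarrow> int" where c: "\<And>t. of_nat C * b t = (\<Sum>u\<in>UNIV. of_int (c t u) * b0 u)"
      using C(2)[OF b] by metis
    have "of_nat C * \<sigma> s (b t) = (\<Sum>u\<in>UNIV. \<sigma> s (b0 u) * of_int (c t u))" for s t
    proof -
      have "\<sigma> s (of_nat C * b t) = \<sigma> s (\<Sum>u\<in>UNIV. of_int (c t u) * b0 u)"
        by (simp add: c)
      then show ?thesis
        by (simp add: emb_mult emb_sum emb_of_nat emb_of_int closed_K O_K[OF b] O_K[OF b0] mult.commute)
    qed
    then have "(\<chi> s. of_nat C *s (\<chi> t. \<sigma> s (b t))) = (\<chi> s t. \<sigma> s (b0 t)) ** transpose (\<chi> t u. of_int (c t u))"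
      by (simp add: vec_eq_iff matrix_matrix_mult_def transpose_def)
    then have "det (\<chi> s. of_nat C *s (\<chi> t. \<sigma> s (b t))) = emb_det b0 * det (\<chi> t u. of_int (c t u))"
      by (simp add: det_mul det_transpose emb_det_def)
    then have "of_nat C ^ CARD('n) * emb_det b / emb_det b0 = det (\<chi> t u. of_int (c t u))"
      using D0 by (simp add: det_rows_mul emb_det_def)
    also have "\<dots> \<in> \<int>"
      by (rule det_Ints) simp
    finally show ?thesis .
  qed
  define ix where "ix b = nat \<lfloor>\<bar>of_nat C ^ CARD('n) * emb_det b / emb_det b0\<bar>\<rfloor>" for b
  have ix: "real (ix b) = of_nat C ^ CARD('n) / \<bar>emb_det b0\<bar> * \<bar>emb_det b\<bar>" if b: "\<And>t. b t \<in> O\<^sub>K" for b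
  proof -
    obtain k where "of_nat C ^ CARD('n) * emb_det b / emb_det b0 = of_int k"
      using quot[of b] b by (auto elim: Ints_cases)
    then have "real (ix b) = \<bar>of_nat C ^ CARD('n) * emb_det b / emb_det b0\<bar>"
      by (simp add: ix_def)
    then show ?thesis
      by (simp add: abs_mult)
  qed
  obtain b where b: "(\<forall>t. b t \<in> O\<^sub>K) \<and> emb_det b \<noteq> 0"
    and min: "\<And>b'. (\<forall>t. b' t \<in> O\<^sub>K) \<and> emb_det b' \<noteq> 0 \<Longrightarrow> ix b \<le> ix b'"
    using ex_has_least_nat[of "\<lambda>b. (\<forall>t. b t \<in> O\<^sub>K) \<and> emb_det b \<noteq> 0" b0 ix] b0 D0 by blast
  have bO: "\<And>t. b t \<in> O\<^sub>K" and Db: "emb_det b \<noteq> 0"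
    using b by auto
  have span: "\<exists>c :: 'n \<Rightarrow> int. x = (\<Sum>t\<in>UNIV. of_int (c t) * b t)" if x: "x \<in> O\<^sub>K" for x
  proof -
    obtain r where r: "\<And>s. \<sigma> s x = (\<Sum>t\<in>UNIV. r t * \<sigma> s (b t))"
      using emb_coordinates[OF Db] by blast
    have "r t \<in> \<int>" for t
    proof (rule ccontr)
      assume "r t \<notin> \<int>"
      then have fr: "0 < frac (r t)" "frac (r t) < 1"
        by (auto simp: frac_gt_0_iff frac_lt_1)
      \<comment> \<open>The new entry has coordinate \<open>frac (r t)\<close> along
        \<open>b t\<close>, so by Cramer's rule exchanging it for \<open>b t\<close> multiplies the
        determinant by exactly this fraction.\<close>
      define b' where "b' = b(t := x - of_int \<lfloor>r t\<rfloor> * b t)"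
      have b'O: "b' u \<in> O\<^sub>K" for u
        by (auto simp: b'_def intro!: closed_O of_int_O bO x)
      define A :: "real^'n^'n" where "A = (\<chi> s t. \<sigma> s (b t))"
      define w where "w = (\<chi> u. r u - (if u = t then of_int \<lfloor>r t\<rfloor> else 0))"
      have "(A *v w) $ s = \<sigma> s (b' t)" for s
      proof -
        have "(A *v w) $ s = (\<Sum>u\<in>UNIV. r u * \<sigma> s (b u) - (if u = t then of_int \<lfloor>r t\<rfloor> * \<sigma> s (b u) else 0))"
          unfolding A_def w_def matrix_vector_mult_def by (auto intro!: sum.cong simp: algebra_simps)
        also have "\<dots> = \<sigma> s x - of_int \<lfloor>r t\<rfloor> * \<sigma> s (b t)"
          by (simp add: sum_subtractf r)
        also have "\<dots> = \<sigma> s (b' t)"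
          by (simp add: b'_def emb_diff emb_mult emb_of_int closed_K O_K[OF x] O_K[OF bO])
        finally show ?thesis .
      qed
      then have "(\<chi> s u. \<sigma> s (b' u)) = (\<chi> s u. if u = t then (A *v w) $ s else A $ s $ u)"
        by (auto simp: vec_eq_iff A_def b'_def)
      then have "emb_det b' = w $ t * det A"
        unfolding emb_det_def by (simp add: cramer_lemma)
      then have det': "emb_det b' = frac (r t) * emb_det b"
        by (simp add: w_def A_def emb_det_def frac_def)
      then have "emb_det b' \<noteq> 0"
        using fr Db by simp
      then have "real (ix b) \<le> real (ix b')"
        using min[of b'] b'O by simp
      moreover have "real (ix b') < real (ix b)"
      proof -
        have "\<bar>emb_det b'\<bar> < 1 * \<bar>emb_det b\<bar>"
          unfolding det' abs_mult using fr Db by (intro mult_strict_right_mono) auto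
        then have "of_nat C ^ CARD('n) / \<bar>emb_det b0\<bar> * \<bar>emb_det b'\<bar> < of_nat C ^ CARD('n) / \<bar>emb_det b0\<bar> * \<bar>emb_det b\<bar>"
          using C(1) D0 by (intro mult_strict_left_mono) auto
        then show ?thesis
          by (simp only: ix[OF bO] ix[OF b'O])
      qed
      ultimately show False by simp
    qed
    then have "\<exists>k. r t = of_int k" for t
      by (auto elim: Ints_cases)
    then obtain c where c: "\<And>t. r t = of_int (c t)"
      by metis
    have "x = (\<Sum>t\<in>UNIV. of_int (c t) * b t)"
    proof (rule eq_if_emb_eq)
      show "\<sigma> s x = \<sigma> s (\<Sum>t\<in>UNIV. of_int (c t) * b t)" for s
        by (simp add: r c emb_sum emb_mult emb_of_int closed_K O_K[OF bO])
    qed (rule O_K[OF x], intro sum_K mult_K of_int_K O_K[OF bO])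
    then show ?thesis by blast
  qed
  have inj: "c = c'" if eq: "(\<Sum>t\<in>UNIV. of_int (c t) * b t) = (\<Sum>t\<in>UNIV. of_int (c' t) * b t)" for c c' :: "'n \<Rightarrow> int"
  proof -
    have emb_comb: "\<sigma> s (\<Sum>t\<in>UNIV. of_int (c t) * b t) = (\<Sum>t\<in>UNIV. of_int (c t) * \<sigma> s (b t))" for s and c :: "'n \<Rightarrow> int"
      by (simp add: emb_sum emb_mult emb_of_int closed_K O_K[OF bO])
    define A :: "real^'n^'n" where "A = (\<chi> s t. \<sigma> s (b t))"
    have "A *v (\<chi> t. of_int (c t - c' t)) = 0"
    proof -
      have "(\<Sum>t\<in>UNIV. of_int (c t) * \<sigma> s (b t)) = (\<Sum>t\<in>UNIV. of_int (c' t) * \<sigma> s (b t))" for s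
        unfolding emb_comb[symmetric] eq ..
      then show ?thesis
        by (simp add: vec_eq_iff matrix_vector_mult_def A_def algebra_simps sum_subtractf)
    qed
    then have "(\<chi> t. of_int (c t - c' t)) = (0 :: real^'n)"
      using Db det_nonzero_iff_ker[of A] by (simp add: A_def emb_det_def)
    then show ?thesis
      by (simp add: vec_eq_iff fun_eq_iff)
  qed
  show ?thesis
    unfolding integral_basis_def bij_betw_def
  proof (intro exI[of _ b] conjI)
    show "inj (\<lambda>c :: 'n \<Rightarrow> int. \<Sum>t\<in>UNIV. of_int (c t) * b t)"
      using inj by (rule injI)
    show "range (\<lambda>c :: 'n \<Rightarrow> int. \<Sum>t\<in>UNIV. of_int (c t) * b t) = O\<^sub>K"
      using span by (auto intro!: sum_O closed_O of_int_O bO)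
  qed
qed

lemma integral_basis_mem:
  fixes b :: "'n \<Rightarrow> real"
  assumes b: "integral_basis K b"
  shows "b t \<in> O\<^sub>K"
proof -
  have "(\<Sum>u\<in>UNIV. of_int (if u = t then 1 else 0) * b u) = (\<Sum>u\<in>UNIV. if u = t then b u else 0)"
    by (intro sum.cong) auto
  then have "b t = (\<lambda>c :: 'n \<Rightarrow> int. \<Sum>u\<in>UNIV. of_int (c u) * b u) (\<lambda>u. if u = t then 1 else 0)"
    by simp
  also have "\<dots> \<in> O\<^sub>K"
    using bij_betwE[OF b[unfolded integral_basis_def]] by (rule bspec) simp
  finally show ?thesis .
qed

lemma integral_basis_span:
  assumes b: "integral_basis K b" and "x \<in> O\<^sub>K"
  obtains c :: "'n \<Rightarrow> int" where "x = (\<Sum>t\<in>UNIV. of_int (c t) * b t)"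
  using assms unfolding integral_basis_def bij_betw_def by auto

text \<open>Every field element has a positive integral multiple, so an integral basis also
  generates the field over the rationals.\<close>

lemma emb_det_integral_basis:
  assumes b: "integral_basis K b"
  shows "emb_det b \<noteq> 0"
proof (rule emb_det_nonzero)
  show "b t \<in> K" for t
    using integral_basis_mem[OF b] O_K by blast
  fix x assume "x \<in> K"
  then obtain q :: nat where q: "q > 0" "of_nat q * x \<in> O\<^sub>K"
    using integral_multiple by blast
  then obtain c :: "'n \<Rightarrow> int" where "of_nat q * x = (\<Sum>t\<in>UNIV. of_int (c t) * b t)"
    using integral_basis_span[OF b] by blast
  then have "x = (\<Sum>t\<in>UNIV. (of_int (c t) / of_nat q) * b t)"
    using q(1) by (simp add: field_simps flip: sum_divide_distrib)
  then show "\<exists>r. (\<forall>t. r t \<in> \<rat>) \<and> x = (\<Sum>t\<in>UNIV. r t * b t)"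
    by (intro exI[of _ "\<lambda>t. of_int (c t) / of_nat q"]) auto
qed

section \<open>Inverses modulo a prime element\<close>

definition dvd_O :: "real \<Rightarrow> real \<Rightarrow> bool" where
  "dvd_O \<rho> x \<longleftrightarrow> (\<exists>c\<in>O\<^sub>K. x = \<rho> * c)"

text \<open>Two powers of \<open>a\<close> agree modulo a rational integer divisible by \<open>\<rho>\<close>.\<close>

lemma inverse_modulo_prime:
  assumes \<rho>: "\<rho> \<in> O\<^sub>K" "\<rho> \<noteq> 0"
    and prime: "\<And>a b. a \<in> O\<^sub>K \<Longrightarrow> b \<in> O\<^sub>K \<Longrightarrow> dvd_O \<rho> (a * b) \<Longrightarrow> dvd_O \<rho> a \<or> dvd_O \<rho> b"
    and a: "a \<in> O\<^sub>K" "\<not> dvd_O \<rho> a"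
  shows "\<exists>a'\<in>O\<^sub>K. dvd_O \<rho> (a' * a - 1)"
proof -
  obtain b :: "'n \<Rightarrow> real" where b: "integral_basis K b"
    using integral_basis_exists by blast
  obtain q :: nat where q: "q > 0" "of_nat q * inverse \<rho> \<in> O\<^sub>K"
    using integral_multiple[OF inverse_K[OF O_K[OF \<rho>(1)]]] by blast
  have dvd_q: "dvd_O \<rho> (of_nat q * x)" if "x \<in> O\<^sub>K" for x
    unfolding dvd_O_def using \<rho>(2) q(2) that
    by (intro bexI[of _ "of_nat q * inverse \<rho> * x"]) (auto intro: mult_O)
  have "\<exists>c :: 'n \<Rightarrow> int. a ^ i = (\<Sum>t\<in>UNIV. of_int (c t) * b t)" for i
    using integral_basis_span[OF b power_O[OF a(1)]] by metis
  then obtain c :: "nat \<Rightarrow> 'n \<Rightarrow> int" where c: "\<And>i. a ^ i = (\<Sum>t\<in>UNIV. of_int (c i t) * b t)"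
    by metis
  \<comment> \<open>Coordinates modulo \<open>q\<close> take finitely many values, and congruence
    modulo \<open>q\<close> implies congruence modulo \<rho>.\<close>
  define cell where "cell i = (\<lambda>t. c i t mod int q)" for i
  have "range cell \<subseteq> PiE UNIV (\<lambda>_. {0..<int q})"
    using q(1) by (auto simp: cell_def)
  then have "finite (range cell)"
    by (rule finite_subset) (auto intro: finite_PiE)
  then have "\<not> inj cell"
    using finite_imageD[of cell UNIV] by auto
  then obtain i j where ij: "i < j" "cell i = cell j"
    unfolding inj_on_def by (metis linorder_neqE_nat)
  have "\<exists>k. c j t - c i t = int q * k" for t
    using ij(2) by (metis cell_def mod_eq_dvd_iff dvd_def)
  then obtain k where k: "\<And>t. c j t - c i t = int q * k t"
    by metis
  have "a ^ j - a ^ i = (\<Sum>t\<in>UNIV. of_int (c j t - c i t) * b t)"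
    by (simp add: c left_diff_distrib sum_subtractf)
  also have "\<dots> = of_nat q * (\<Sum>t\<in>UNIV. of_int (k t) * b t)"
    by (simp add: k sum_distrib_left mult_ac)
  finally have "dvd_O \<rho> (a ^ j - a ^ i)"
    by (simp add: dvd_q sum_O mult_O of_int_O integral_basis_mem[OF b])
  moreover have "a ^ j - a ^ i = a ^ i * (a ^ (j - i) - 1)"
    using ij(1) by (simp add: right_diff_distrib flip: power_add)
  moreover have not_dvd: "\<not> dvd_O \<rho> (a ^ Suc m)" for m
  proof (induction m)
    case (Suc m)
    then show ?case
      using prime[OF a(1) power_O[OF a(1)], of "Suc m"] a(2) by auto
  qed (use a(2) in simp)
  \<comment> \<open>Primality cancels \<open>a ^ i\<close> from the congruence. What remains says
    that \<open>a ^ (j - i)\<close> is 1 modulo \<rho>, so \<open>a ^ (j - i - 1)\<close> is the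
    inverse.\<close>
  ultimately have *: "dvd_O \<rho> (a ^ i) \<or> dvd_O \<rho> (a ^ (j - i) - 1)"
    using prime[OF power_O[OF a(1)] diff_O[OF power_O[OF a(1)] one_O]] by metis
  have "dvd_O \<rho> (a ^ (j - i) - 1)"
  proof (cases i)
    case 0
    show ?thesis
    proof (rule ccontr)
      assume "\<not> ?thesis"
      with * 0 have "dvd_O \<rho> 1" by simp
      then have "dvd_O \<rho> a"
        unfolding dvd_O_def using a(1) by (metis mult.assoc mult_1 mult_O)
      with a(2) show False ..
    qed
  next
    case (Suc m)
    with * not_dvd[of m] show ?thesis by simp
  qed
  then show ?thesis
    using ij(1) power_O[OF a(1), of "j - i - 1"]
    by (intro bexI[of _ "a ^ (j - i - 1)"]) (auto simp: power_minus_mult simp del: diff_Suc_eq_diff_pred diff_diff_left One_nat_def)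
qed

end

section \<open>Coordinates in the quaternion order\<close>

lemma det_4:
  fixes A :: "'a::comm_ring_1^4^4"
  shows "det A =
    A$1$1 * (A$2$2 * (A$3$3 * A$4$4 - A$3$4 * A$4$3) - A$2$3 * (A$3$2 * A$4$4 - A$3$4 * A$4$2) + A$2$4 * (A$3$2 * A$4$3 - A$3$3 * A$4$2))
  - A$1$2 * (A$2$1 * (A$3$3 * A$4$4 - A$3$4 * A$4$3) - A$2$3 * (A$3$1 * A$4$4 - A$3$4 * A$4$1) + A$2$4 * (A$3$1 * A$4$3 - A$3$3 * A$4$1))
  + A$1$3 * (A$2$1 * (A$3$2 * A$4$4 - A$3$4 * A$4$2) - A$2$2 * (A$3$1 * A$4$4 - A$3$4 * A$4$1) + A$2$4 * (A$3$1 * A$4$2 - A$3$2 * A$4$1))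
  - A$1$4 * (A$2$1 * (A$3$2 * A$4$3 - A$3$3 * A$4$2) - A$2$2 * (A$3$1 * A$4$3 - A$3$3 * A$4$1) + A$2$3 * (A$3$1 * A$4$2 - A$3$2 * A$4$1))"
proof -
  have f1234: "finite {2::4, 3, 4}" "1 \<notin> {2::4, 3, 4}"
    and f234: "finite {3::4, 4}" "2 \<notin> {3::4, 4}"
    and f34: "finite {4::4}" "3 \<notin> {4::4}" by auto
  show ?thesis
    unfolding det_def UNIV_4
    unfolding sum_over_permutations_insert[OF f1234]
    unfolding sum_over_permutations_insert[OF f234]
    unfolding sum_over_permutations_insert[OF f34]
    unfolding permutes_sing
    by (simp add: sign_swap_id permutation_swap_id sign_compose sign_id permutation_compose algebra_simps)
qed

lemma [simp]:
  "(vector [x, y, z, w] :: 'a::zero^4) $ 1 = x"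
  "(vector [x, y, z, w] :: 'a::zero^4) $ 2 = y"
  "(vector [x, y, z, w] :: 'a::zero^4) $ 3 = z"
  "(vector [x, y, z, w] :: 'a::zero^4) $ 4 = w"
  by (simp_all add: vector_def)

definition quat_comb :: "real \<Rightarrow> real \<Rightarrow> real \<Rightarrow> real \<Rightarrow> real^4 \<Rightarrow> quaternion" where
  "quat_comb \<mu> \<nu> S T v = of_real (v $ 1) + of_real (v $ 2) * quat_alpha \<mu> S + of_real (v $ 3) * quat_beta \<nu> S T
     + of_real (v $ 4) * (quat_alpha \<mu> S * quat_beta \<nu> S T)"

text \<open>The columns are the real components of 1, \<alpha>, \<beta> and \<alpha>\<beta>. The
  matrix is triangular with determinant T/4, the source of the factor N(T)/4^n in the
  covolume.\<close>

definition quat_coord_matrix :: "real \<Rightarrow> real \<Rightarrow> real \<Rightarrow> real \<Rightarrow> real^4^4" where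
  "quat_coord_matrix \<mu> \<nu> S T = vector
     [vector [1, \<mu> / 2, 0, - \<nu> / 2],
      vector [0, sqrt S / 2, \<nu> / sqrt S, \<mu> * \<nu> / (2 * sqrt S)],
      vector [0, 0, sqrt T / sqrt S, \<mu> * sqrt T / (2 * sqrt S)],
      vector [0, 0, 0, sqrt T / 2]]"

lemmas quat_simps = quaternion_eq_iff zero_quaternion_def one_quaternion_def plus_quaternion_def
  uminus_quaternion_def minus_quaternion_def times_quaternion_def scaleR_quaternion_def of_real_def

lemma quat_alpha_components: "quat_alpha \<mu> S = Quat (\<mu> / 2) (sqrt S / 2) 0 0"
  by (simp add: quat_alpha_def quat_simps quat_i_def)

lemma quat_beta_components: "quat_beta \<nu> S T = Quat 0 (\<nu> / sqrt S) (sqrt T / sqrt S) 0"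
  by (simp add: quat_beta_def quat_simps quat_i_def quat_j_def divide_inverse_commute)

lemma quat_comb_scaleR_form:
  "quat_comb \<mu> \<nu> S T v = (v $ 1) *\<^sub>R 1 + (v $ 2) *\<^sub>R quat_alpha \<mu> S + (v $ 3) *\<^sub>R quat_beta \<nu> S T
     + (v $ 4) *\<^sub>R (quat_alpha \<mu> S * quat_beta \<nu> S T)"
  by (simp add: quat_comb_def scaleR_conv_of_real[where 'a = quaternion])

lemma quat_comb_components:
  assumes "S > 0"
  shows "quat_comb \<mu> \<nu> S T v = Quat ((quat_coord_matrix \<mu> \<nu> S T *v v) $ 1)
    ((quat_coord_matrix \<mu> \<nu> S T *v v) $ 2) ((quat_coord_matrix \<mu> \<nu> S T *v v) $ 3)
    ((quat_coord_matrix \<mu> \<nu> S T *v v) $ 4)"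
  using assms
  by (simp add: quat_comb_scaleR_form quat_coord_matrix_def quat_alpha_components quat_beta_components
      matrix_vector_mult_def sum_4 quat_simps mult_ac)

lemma det_quat_coord_matrix:
  assumes "S > 0" "T > 0"
  shows "det (quat_coord_matrix \<mu> \<nu> S T) = T / 4"
  using assms by (simp add: det_4 quat_coord_matrix_def)

lemma quat_norm_comb:
  assumes "S > 0"
  shows "quat_norm (quat_comb \<mu> \<nu> S T v) = (norm (quat_coord_matrix \<mu> \<nu> S T *v v))\<^sup>2"
  by (simp only: quat_comb_components[OF assms] quat_norm_def power2_norm_eq_inner inner_vec_def sum_4)
    (simp add: power2_eq_square)

text \<open>All square roots disappear from the norm form, leaving field operations in the
  coordinates and in \<mu>, \<nu>, \<open>S\<close>, \<open>T\<close>. Embeddings commute with such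
  an expression.\<close>

lemma quat_norm_comb_rational:
  assumes "S > 0" "T > 0"
  shows "(norm (quat_coord_matrix \<mu> \<nu> S T *v v))\<^sup>2 =
    (v$1 + v$2 * \<mu> / 2 - v$4 * \<nu> / 2)\<^sup>2 + (v$2 * S / 2 + v$3 * \<nu> + v$4 * \<mu> * \<nu> / 2)\<^sup>2 / S
      + T / S * (v$3 + v$4 * \<mu> / 2)\<^sup>2 + T / 4 * (v$4)\<^sup>2"
proof -
  let ?w = "quat_coord_matrix \<mu> \<nu> S T *v v"
  have "(?w $ 2)\<^sup>2 = (v$2 * S / 2 + v$3 * \<nu> + v$4 * \<mu> * \<nu> / 2)\<^sup>2 / S"
  proof -
    have "?w $ 2 = (v$2 * (sqrt S * sqrt S) / 2 + v$3 * \<nu> + v$4 * \<mu> * \<nu> / 2) / sqrt S"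
      using assms by (simp add: quat_coord_matrix_def matrix_vector_mult_def sum_4 field_simps del: real_sqrt_mult_self)
    then show ?thesis
      using assms by (simp add: power_divide)
  qed
  moreover have "(?w $ 3)\<^sup>2 = T / S * (v$3 + v$4 * \<mu> / 2)\<^sup>2"
  proof -
    have "?w $ 3 = sqrt T / sqrt S * (v$3 + v$4 * \<mu> / 2)"
      by (simp add: quat_coord_matrix_def matrix_vector_mult_def sum_4 distrib_left mult_ac)
    then show ?thesis
      using assms by (simp add: power_mult_distrib power_divide)
  qed
  moreover have "(?w $ 4)\<^sup>2 = T / 4 * (v$4)\<^sup>2"
    using assms by (simp add: quat_coord_matrix_def matrix_vector_mult_def sum_4 power_mult_distrib power_divide)
  moreover have "?w $ 1 = v$1 + v$2 * \<mu> / 2 - v$4 * \<nu> / 2"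
    by (simp add: quat_coord_matrix_def matrix_vector_mult_def sum_4 mult_ac)
  moreover have "(norm ?w)\<^sup>2 = (?w $ 1)\<^sup>2 + (?w $ 2)\<^sup>2 + (?w $ 3)\<^sup>2 + (?w $ 4)\<^sup>2"
    by (simp only: power2_norm_eq_inner inner_vec_def sum_4) (simp add: power2_eq_square)
  ultimately show ?thesis by simp
qed

lemma quat_comb_add: "quat_comb \<mu> \<nu> S T (v + w) = quat_comb \<mu> \<nu> S T v + quat_comb \<mu> \<nu> S T w"
  by (simp add: quat_comb_scaleR_form algebra_simps)

lemma quat_comb_scaleR: "quat_comb \<mu> \<nu> S T (r *\<^sub>R v) = r *\<^sub>R quat_comb \<mu> \<nu> S T v"
  by (simp add: quat_comb_scaleR_form algebra_simps)

lemma quat_comb_inj: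
  assumes "S > 0" "T > 0" "quat_comb \<mu> \<nu> S T v = quat_comb \<mu> \<nu> S T w"
  shows "v = w"
proof -
  have "quat_coord_matrix \<mu> \<nu> S T *v v = quat_coord_matrix \<mu> \<nu> S T *v w"
    using assms by (simp add: quat_comb_components vec_eq_iff forall_4)
  then have "quat_coord_matrix \<mu> \<nu> S T *v (v - w) = 0"
    by (simp add: matrix_vector_mult_diff_distrib)
  then have "v - w = 0"
    using det_nonzero_iff_ker[of "quat_coord_matrix \<mu> \<nu> S T"] det_quat_coord_matrix[OF assms(1,2)] assms(2) by auto
  then show ?thesis by simp
qed

text \<open>Left multiplication by \<open>\<alpha>\<close> and \<open>\<beta>\<close> in the coordinates with respect to \<open>1, \<alpha>, \<beta>, \<alpha>\<beta>\<close>, from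
  \<open>\<alpha>\<^sup>2 = \<mu>\<alpha> - A\<close>, \<open>\<beta>\<^sup>2 = - B\<close> and \<open>\<beta>\<alpha> = \<mu>\<beta> - \<nu> - \<alpha>\<beta>\<close>.\<close>

definition alpha_mult :: "real \<Rightarrow> real \<Rightarrow> real^4 \<Rightarrow> real^4" where
  "alpha_mult A \<mu> v = vector [- A * v$2, v$1 + \<mu> * v$2, - A * v$4, v$3 + \<mu> * v$4]"

definition beta_mult :: "real \<Rightarrow> real \<Rightarrow> real \<Rightarrow> real^4 \<Rightarrow> real^4" where
  "beta_mult B \<mu> \<nu> v = vector [- \<nu> * v$2 - B * v$3 - B * \<mu> * v$4, B * v$4, v$1 + \<mu> * v$2 - \<nu> * v$4, - v$2]"

lemma quat_beta_square:
  assumes "S > 0" "T > 0" "T = B * S - \<nu>\<^sup>2"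
  shows "quat_beta \<nu> S T * quat_beta \<nu> S T = of_real (- B)"
proof -
  have "\<nu>\<^sup>2 / S + T / S = B"
    using assms(1,3) by (simp add: field_simps)
  then show ?thesis
    using assms(1,2) by (simp add: quat_beta_components quat_simps power2_eq_square)
qed

lemma quat_alpha_square:
  assumes "S > 0" "S = 4 * A - \<mu>\<^sup>2"
  shows "quat_alpha \<mu> S * quat_alpha \<mu> S = of_real \<mu> * quat_alpha \<mu> S - of_real A"
proof -
  have "\<mu>\<^sup>2 / 4 - S / 4 = \<mu>\<^sup>2 / 2 - A"
    using assms(2) by (simp add: field_simps)
  then show ?thesis
    using assms(1) by (simp add: quat_alpha_components quat_simps power2_eq_square)
qed

lemma quat_beta_alpha:
  assumes "S > 0"
  shows "quat_beta \<nu> S T * quat_alpha \<mu> S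
    = of_real \<mu> * quat_beta \<nu> S T - of_real \<nu> - quat_alpha \<mu> S * quat_beta \<nu> S T"
  using assms by (simp add: quat_alpha_components quat_beta_components quat_simps mult_ac)

lemma quat_alpha_comb:
  assumes "S > 0" "S = 4 * A - \<mu>\<^sup>2"
  shows "quat_alpha \<mu> S * quat_comb \<mu> \<nu> S T v = quat_comb \<mu> \<nu> S T (alpha_mult A \<mu> v)"
proof -
  define a b where "a = quat_alpha \<mu> S" and "b = quat_beta \<nu> S T"
  have aa: "a * a = \<mu> *\<^sub>R a - A *\<^sub>R 1"
    using quat_alpha_square[OF assms] by (simp add: a_def scaleR_conv_of_real)
  have aab: "a * (a * b) = \<mu> *\<^sub>R (a * b) - A *\<^sub>R b"
    by (simp add: mult.assoc[symmetric] aa left_diff_distrib)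
  show ?thesis
    unfolding quat_comb_scaleR_form a_def[symmetric] b_def[symmetric]
    by (simp add: alpha_mult_def distrib_left aa aab scaleR_diff_right scaleR_left_distrib) (simp add: mult_ac)
qed

lemma quat_beta_comb:
  assumes "S > 0" "T > 0" "T = B * S - \<nu>\<^sup>2"
  shows "quat_beta \<nu> S T * quat_comb \<mu> \<nu> S T v = quat_comb \<mu> \<nu> S T (beta_mult B \<mu> \<nu> v)"
proof -
  define a b where "a = quat_alpha \<mu> S" and "b = quat_beta \<nu> S T"
  have bb: "b * b = - B *\<^sub>R 1"
    using quat_beta_square[OF assms] by (simp add: b_def scaleR_conv_of_real)
  have ba: "b * a = \<mu> *\<^sub>R b - \<nu> *\<^sub>R 1 - a * b"
    using quat_beta_alpha[OF assms(1)] by (simp add: a_def b_def scaleR_conv_of_real)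
  have bab: "b * (a * b) = - (B * \<mu>) *\<^sub>R 1 - \<nu> *\<^sub>R b + B *\<^sub>R a"
  proof -
    have "b * (a * b) = (b * a) * b"
      by (simp only: mult.assoc)
    also have "\<dots> = \<mu> *\<^sub>R (b * b) - \<nu> *\<^sub>R b - a * (b * b)"
      by (simp add: ba algebra_simps)
    finally show ?thesis
      by (simp add: bb)
  qed
  show ?thesis
    unfolding quat_comb_scaleR_form a_def[symmetric] b_def[symmetric]
    by (simp add: beta_mult_def distrib_left bb ba bab scaleR_diff_right scaleR_right_distrib scaleR_left_distrib
        scaleR_left_diff_distrib) (simp add: mult_ac)
qed

text \<open>In the columns \<open>p\<close> and \<open>q\<close> the rows \<open>v\<close> and
  \<open>w\<close> form an identity block, and the other two rows are \<open>r\<close> times unit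
  vectors; up to a simultaneous reordering the matrix is block triangular. This is how two pivots
  reduce the determinant from r^4 to r^2.\<close>

lemma det_two_pivots:
  fixes v w :: "real^4"
  assumes "p \<noteq> q" "v $ p = 1" "v $ q = 0" "w $ p = 0" "w $ q = 1"
  shows "det (\<chi> i. if i = p then v else if i = q then w else r *\<^sub>R axis i 1) = r\<^sup>2"
  using exhaust_4[of p] exhaust_4[of q] assms
  by (elim disjE) (simp_all add: det_4 axis_def power2_eq_square)

lemma alpha_mult_add: "alpha_mult A \<mu> (v + w) = alpha_mult A \<mu> v + alpha_mult A \<mu> w"
  and alpha_mult_scaleR: "alpha_mult A \<mu> (r *\<^sub>R v) = r *\<^sub>R alpha_mult A \<mu> v"
  and beta_mult_add: "beta_mult B \<mu> \<nu> (v + w) = beta_mult B \<mu> \<nu> v + beta_mult B \<mu> \<nu> w"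
  and beta_mult_scaleR: "beta_mult B \<mu> \<nu> (r *\<^sub>R v) = r *\<^sub>R beta_mult B \<mu> \<nu> v"
  by (simp_all add: vec_eq_iff forall_4 alpha_mult_def beta_mult_def algebra_simps)

text \<open>Left multiplication by \<alpha>\<beta> - \<beta>\<alpha> in coordinates. In the real
  quaternions this element is sqrt(T) k, which explains why its square is the scalar -T; in
  coordinates that is a polynomial identity, fit for reduction modulo \<rho>.\<close>

definition commutator_mult :: "real \<Rightarrow> real \<Rightarrow> real \<Rightarrow> real \<Rightarrow> real^4 \<Rightarrow> real^4" where
  "commutator_mult A B \<mu> \<nu> v = alpha_mult A \<mu> (beta_mult B \<mu> \<nu> v) - beta_mult B \<mu> \<nu> (alpha_mult A \<mu> v)"

lemma commutator_mult_square:
  assumes "S = 4 * A - \<mu>\<^sup>2" "T = B * S - \<nu>\<^sup>2"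
  shows "commutator_mult A B \<mu> \<nu> (commutator_mult A B \<mu> \<nu> v) = - T *\<^sub>R v"
  unfolding assms
  by (simp add: vec_eq_iff forall_4 commutator_mult_def alpha_mult_def beta_mult_def power2_eq_square)
    (simp add: algebra_simps)

section \<open>The left ideal modulo a prime\<close>

locale quaternion_order = embedded_number_field K \<sigma>
  for K :: "real set" and \<sigma> :: "'n::finite \<Rightarrow> real \<Rightarrow> real" +
  fixes A B \<mu> \<nu> S T :: real
  assumes A_O: "A \<in> O\<^sub>K" and B_O: "B \<in> O\<^sub>K" and \<mu>_O: "\<mu> \<in> O\<^sub>K" and \<nu>_O: "\<nu> \<in> O\<^sub>K"
    and S_eq: "S = 4 * A - \<mu>\<^sup>2" and T_eq: "T = B * S - \<nu>\<^sup>2"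
    and S_tot_pos: "totally_positive \<sigma> S" and T_tot_pos: "totally_positive \<sigma> T"
begin

definition OV :: "(real^4) set" where "OV = {v. \<forall>i. v $ i \<in> O\<^sub>K}"

abbreviation "comb \<equiv> quat_comb \<mu> \<nu> S T"
abbreviation "H \<equiv> quat_order K \<mu> \<nu> S T"
abbreviation "\<alpha> \<equiv> alpha_mult A \<mu>"
abbreviation "\<beta> \<equiv> beta_mult B \<mu> \<nu>"

lemma S_O: "S \<in> O\<^sub>K" and T_O: "T \<in> O\<^sub>K"
proof -
  have "4 \<in> O\<^sub>K"
    using of_int_O[of 4] by simp
  then show "S \<in> O\<^sub>K"
    unfolding S_eq by (intro closed_O A_O \<mu>_O)
  then show "T \<in> O\<^sub>K"
    unfolding T_eq by (intro closed_O B_O \<nu>_O)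
qed

lemma S_pos: "S > 0" and T_pos: "T > 0"
  using emb_id S_tot_pos T_tot_pos O_K[OF S_O] O_K[OF T_O] by (auto simp: totally_positive_def) metis+

lemma H_eq: "H = comb ` OV"
proof (intro equalityI subsetI)
  fix L assume "L \<in> H"
  then obtain x y z w where xyzw: "x \<in> O\<^sub>K" "y \<in> O\<^sub>K" "z \<in> O\<^sub>K" "w \<in> O\<^sub>K"
    "L = of_real x + of_real y * quat_alpha \<mu> S + of_real z * quat_beta \<nu> S T
        + of_real w * (quat_alpha \<mu> S * quat_beta \<nu> S T)"
    by (auto simp: quat_order_def)
  then show "L \<in> comb ` OV"
    by (intro image_eqI[of _ _ "vector [x, y, z, w]"]) (auto simp: quat_comb_def OV_def forall_4)
next
  fix L assume "L \<in> comb ` OV"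
  then obtain v where "v \<in> OV" "L = comb v"
    by blast
  then show "L \<in> H"
    unfolding quat_order_def quat_comb_def OV_def by blast
qed

lemma OV_add: "v \<in> OV \<Longrightarrow> w \<in> OV \<Longrightarrow> v + w \<in> OV"
  and OV_diff: "v \<in> OV \<Longrightarrow> w \<in> OV \<Longrightarrow> v - w \<in> OV"
  and OV_scaleR: "r \<in> O\<^sub>K \<Longrightarrow> v \<in> OV \<Longrightarrow> r *\<^sub>R v \<in> OV"
  and OV_axis: "axis i 1 \<in> OV"
  and OV_zero: "0 \<in> OV"
  and OV_alpha: "v \<in> OV \<Longrightarrow> \<alpha> v \<in> OV"
  and OV_beta: "v \<in> OV \<Longrightarrow> \<beta> v \<in> OV"
  by (auto simp: OV_def axis_def alpha_mult_def beta_mult_def forall_4 intro!: closed_O A_O B_O \<mu>_O \<nu>_O)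

lemma OV_nth: "v \<in> OV \<Longrightarrow> v $ i \<in> O\<^sub>K"
  by (simp add: OV_def)

lemma comb_alpha: "quat_alpha \<mu> S * comb v = comb (\<alpha> v)"
  by (rule quat_alpha_comb[OF S_pos S_eq])

lemma comb_beta: "quat_beta \<nu> S T * comb v = comb (\<beta> v)"
  by (rule quat_beta_comb[OF S_pos T_pos T_eq])

text \<open>Coordinate vectors of the left ideal HL + \<rho>H. This is \<rho> times the set
  occurring in the definition of suitability, so that all entries remain integral.\<close>

definition left_ideal :: "real \<Rightarrow> quaternion \<Rightarrow> (real^4) set" where
  "left_ideal \<rho> L = {v \<in> OV. \<exists>D\<in>H. \<exists>C\<in>H. comb v = D * L + \<rho> *\<^sub>R C}"

lemma left_ideal_add:
  assumes "v \<in> left_ideal \<rho> L" "w \<in> left_ideal \<rho> L"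
  shows "v + w \<in> left_ideal \<rho> L"
proof -
  obtain d c d' c' where *: "v \<in> OV" "w \<in> OV" "d \<in> OV" "c \<in> OV" "d' \<in> OV" "c' \<in> OV"
    "comb v = comb d * L + \<rho> *\<^sub>R comb c" "comb w = comb d' * L + \<rho> *\<^sub>R comb c'"
    using assms by (auto simp: left_ideal_def H_eq)
  then have "comb (v + w) = comb (d + d') * L + \<rho> *\<^sub>R comb (c + c')"
    by (simp add: quat_comb_add algebra_simps)
  then show ?thesis
    using * unfolding left_ideal_def H_eq by (auto intro!: OV_add)
qed

lemma left_ideal_scaleR:
  assumes "r \<in> O\<^sub>K" "v \<in> left_ideal \<rho> L"
  shows "r *\<^sub>R v \<in> left_ideal \<rho> L"
proof -
  obtain d c where *: "v \<in> OV" "d \<in> OV" "c \<in> OV" "comb v = comb d * L + \<rho> *\<^sub>R comb c"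
    using assms by (auto simp: left_ideal_def H_eq)
  then have "comb (r *\<^sub>R v) = comb (r *\<^sub>R d) * L + \<rho> *\<^sub>R comb (r *\<^sub>R c)"
    by (simp add: quat_comb_scaleR algebra_simps)
  then show ?thesis
    using * assms(1) unfolding left_ideal_def H_eq by (auto intro!: OV_scaleR)
qed

lemma left_ideal_diff:
  assumes "v \<in> left_ideal \<rho> L" "w \<in> left_ideal \<rho> L"
  shows "v - w \<in> left_ideal \<rho> L"
  using left_ideal_add[OF assms(1) left_ideal_scaleR[OF uminus_O[OF one_O] assms(2)]] by simp

lemma left_ideal_sum:
  assumes "\<And>i. i \<in> I \<Longrightarrow> f i \<in> left_ideal \<rho> L" "0 \<in> left_ideal \<rho> L"
  shows "sum f I \<in> left_ideal \<rho> L"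
  using assms by (induction I rule: infinite_finite_induct) (auto intro: left_ideal_add)

lemma left_ideal_rho:
  assumes "\<rho> \<in> O\<^sub>K" "v \<in> OV"
  shows "\<rho> *\<^sub>R v \<in> left_ideal \<rho> L"
proof -
  have "comb (\<rho> *\<^sub>R v) = comb 0 * L + \<rho> *\<^sub>R comb v"
    by (simp add: quat_comb_scaleR) (simp add: quat_comb_def)
  then show ?thesis
    using assms unfolding left_ideal_def H_eq by (auto intro!: OV_scaleR OV_zero)
qed

lemma left_ideal_alpha:
  assumes "v \<in> left_ideal \<rho> L"
  shows "\<alpha> v \<in> left_ideal \<rho> L"
proof -
  obtain d c where *: "v \<in> OV" "d \<in> OV" "c \<in> OV" "comb v = comb d * L + \<rho> *\<^sub>R comb c"
    using assms by (auto simp: left_ideal_def H_eq)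
  then have "comb (\<alpha> v) = comb (\<alpha> d) * L + \<rho> *\<^sub>R comb (\<alpha> c)"
    by (simp add: comb_alpha[symmetric] algebra_simps)
  then show ?thesis
    using * unfolding left_ideal_def H_eq by (auto intro!: OV_alpha)
qed

lemma left_ideal_beta:
  assumes "v \<in> left_ideal \<rho> L"
  shows "\<beta> v \<in> left_ideal \<rho> L"
proof -
  obtain d c where *: "v \<in> OV" "d \<in> OV" "c \<in> OV" "comb v = comb d * L + \<rho> *\<^sub>R comb c"
    using assms by (auto simp: left_ideal_def H_eq)
  then have "comb (\<beta> v) = comb (\<beta> d) * L + \<rho> *\<^sub>R comb (\<beta> c)"
    by (simp add: comb_beta[symmetric] algebra_simps)
  then show ?thesis
    using * unfolding left_ideal_def H_eq by (auto intro!: OV_beta)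
qed

lemma left_ideal_OV: "v \<in> left_ideal \<rho> L \<Longrightarrow> v \<in> OV"
  by (simp add: left_ideal_def)

lemma left_ideal_generator:
  assumes "l \<in> OV"
  shows "l \<in> left_ideal \<rho> (comb l)"
proof -
  have "comb l = comb (axis 1 1) * comb l + \<rho> *\<^sub>R comb 0"
  proof -
    have "comb (axis 1 1) = 1" "comb 0 = 0"
      by (simp_all add: quat_comb_def axis_def)
    then show ?thesis by simp
  qed
  then show ?thesis
    using assms unfolding left_ideal_def H_eq by (auto intro!: OV_axis OV_zero)
qed

text \<open>Scaling by an inverse of \<open>v $ p\<close> modulo \<rho> makes the coordinate
  congruent to 1, and subtracting a multiple of \<rho> times a unit vector, which lies in the ideal,
  makes it equal to 1. Only coordinate \<open>p\<close> is corrected, so zeros elsewhere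
  survive.\<close>

lemma normalize_coordinate:
  assumes \<rho>: "\<rho> \<in> O\<^sub>K" "\<rho> \<noteq> 0"
    and prime: "\<And>a b. a \<in> O\<^sub>K \<Longrightarrow> b \<in> O\<^sub>K \<Longrightarrow> dvd_O \<rho> (a * b) \<Longrightarrow> dvd_O \<rho> a \<or> dvd_O \<rho> b"
    and v: "v \<in> left_ideal \<rho> L" "\<not> dvd_O \<rho> (v $ p)"
  shows "\<exists>w\<in>left_ideal \<rho> L. w $ p = 1 \<and> (\<forall>i. i \<noteq> p \<longrightarrow> v $ i = 0 \<longrightarrow> w $ i = 0)"
proof -
  obtain a c where a: "a \<in> O\<^sub>K" "c \<in> O\<^sub>K" "a * v $ p - 1 = \<rho> * c"
    using inverse_modulo_prime[OF \<rho> prime OV_nth[OF left_ideal_OV[OF v(1)]] v(2)] by (auto simp: dvd_O_def)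
  have "a *\<^sub>R v - \<rho> *\<^sub>R (c *\<^sub>R axis p 1) \<in> left_ideal \<rho> L"
    using a v \<rho> by (intro left_ideal_diff left_ideal_scaleR left_ideal_rho OV_scaleR OV_axis)
  then show ?thesis
    using a(3) by (intro bexI[of _ "a *\<^sub>R v - \<rho> *\<^sub>R (c *\<^sub>R axis p 1)"]) (auto simp: axis_def)
qed

text \<open>If left multiplication by both generators acted as scalars on a nonzero residue vector, their
  commutator, whose square is \<open>- T\<close>, would annihilate it; so the ideal has rank at least 2 modulo the
  prime.\<close>

lemma two_pivots:
  assumes \<rho>: "\<rho> \<in> O\<^sub>K" "\<rho> \<noteq> 0"
    and prime: "\<And>a b. a \<in> O\<^sub>K \<Longrightarrow> b \<in> O\<^sub>K \<Longrightarrow> dvd_O \<rho> (a * b) \<Longrightarrow> dvd_O \<rho> a \<or> dvd_O \<rho> b"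
    and T: "\<not> dvd_O \<rho> T"
    and l: "l \<in> left_ideal \<rho> L" "\<not> dvd_O \<rho> (l $ p0)"
  shows "\<exists>p q. \<exists>v\<in>left_ideal \<rho> L. \<exists>w\<in>left_ideal \<rho> L. p \<noteq> q \<and> v $ p = 1 \<and> v $ q = 0 \<and> w $ p = 0 \<and> w $ q = 1"
proof -
  obtain w where w: "w \<in> left_ideal \<rho> L" "w $ p0 = 1"
    using normalize_coordinate[OF \<rho> prime l] by blast
  \<comment> \<open>Since \<open>w $ p0 = 1\<close>, the only possible scalars for the two actions
    on \<open>w\<close> are the coordinates at \<open>p0\<close>; \<open>ua\<close> and
    \<open>ub\<close> measure the failure to be scalar.\<close>
  define ua where "ua = \<alpha> w - (\<alpha> w $ p0) *\<^sub>R w"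
  define ub where "ub = \<beta> w - (\<beta> w $ p0) *\<^sub>R w"
  have a: "\<alpha> w $ p0 \<in> O\<^sub>K" and b: "\<beta> w $ p0 \<in> O\<^sub>K"
    using w by (auto intro: OV_nth OV_alpha OV_beta left_ideal_OV)
  have u: "ua \<in> left_ideal \<rho> L" "ub \<in> left_ideal \<rho> L" "ua $ p0 = 0" "ub $ p0 = 0"
    using w a b by (auto simp: ua_def ub_def intro!: left_ideal_diff left_ideal_scaleR left_ideal_alpha left_ideal_beta)
  have "\<exists>u\<in>left_ideal \<rho> L. u $ p0 = 0 \<and> (\<exists>q. \<not> dvd_O \<rho> (u $ q))"
  proof (rule ccontr)
    assume neg: "\<not> ?thesis"
    have "\<exists>y\<in>OV. x = \<rho> *\<^sub>R y" if "\<And>q. dvd_O \<rho> (x $ q)" for x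
    proof -
      obtain f where "\<And>q. f q \<in> O\<^sub>K" "\<And>q. x $ q = \<rho> * f q"
        using \<open>\<And>q. dvd_O \<rho> (x $ q)\<close> unfolding dvd_O_def by metis
      then show ?thesis
        by (intro bexI[of _ "\<chi> q. f q"]) (auto simp: vec_eq_iff OV_def)
    qed
    then obtain y z where y: "y \<in> OV" "ua = \<rho> *\<^sub>R y" and z: "z \<in> OV" "ub = \<rho> *\<^sub>R z"
      using neg u by meson
    let ?a = "\<alpha> w $ p0" and ?b = "\<beta> w $ p0" and ?\<gamma> = "commutator_mult A B \<mu> \<nu>"
    have aw: "\<alpha> w = ?a *\<^sub>R w + \<rho> *\<^sub>R y" and bw: "\<beta> w = ?b *\<^sub>R w + \<rho> *\<^sub>R z"
      using y z by (auto simp: ua_def ub_def algebra_simps)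
    \<comment> \<open>In the commutator applied to \<open>w\<close> the products of the two scalars
      cancel, and \<open>x\<close> is the cofactor of \<rho> in what remains.\<close>
    define x where "x = ?b *\<^sub>R y + \<alpha> z - (?a *\<^sub>R z + \<beta> y)"
    have "\<alpha> (\<beta> w) = ?b *\<^sub>R \<alpha> w + \<rho> *\<^sub>R \<alpha> z"
      by (subst bw) (simp only: alpha_mult_add alpha_mult_scaleR)
    moreover have "\<beta> (\<alpha> w) = ?a *\<^sub>R \<beta> w + \<rho> *\<^sub>R \<beta> y"
      by (subst aw) (simp only: beta_mult_add beta_mult_scaleR)
    ultimately have "?\<gamma> w = ?b *\<^sub>R (?a *\<^sub>R w + \<rho> *\<^sub>R y) + \<rho> *\<^sub>R \<alpha> z - (?a *\<^sub>R (?b *\<^sub>R w + \<rho> *\<^sub>R z) + \<rho> *\<^sub>R \<beta> y)"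
      unfolding commutator_mult_def using aw bw by metis
    then have "?\<gamma> w = \<rho> *\<^sub>R x"
      by (simp add: x_def algebra_simps)
    then have "- T *\<^sub>R w = \<rho> *\<^sub>R ?\<gamma> x"
      using commutator_mult_square[OF S_eq T_eq, of w]
      by (simp add: commutator_mult_def alpha_mult_scaleR beta_mult_scaleR scaleR_diff_right)
    \<comment> \<open>Reading the vector equation at \<open>p0\<close>, where \<open>w\<close> is 1,
      turns it into divisibility of \<open>T\<close>.\<close>
    then have "- T = \<rho> * ?\<gamma> x $ p0"
      using w(2) by (metis mult.right_neutral real_scaleR_def vector_scaleR_component)
    moreover have "x \<in> OV"
      unfolding x_def by (intro OV_add OV_diff OV_scaleR OV_alpha OV_beta a b y z)
    then have "?\<gamma> x $ p0 \<in> O\<^sub>K"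
      unfolding commutator_mult_def by (intro OV_nth OV_diff OV_alpha OV_beta)
    ultimately have "dvd_O \<rho> T"
      unfolding dvd_O_def by (intro bexI[of _ "- (?\<gamma> x $ p0)"]) (auto intro: uminus_O)
    with T show False ..
  qed
  then obtain u q where u: "u \<in> left_ideal \<rho> L" "u $ p0 = 0" "\<not> dvd_O \<rho> (u $ q)"
    by blast
  have "q \<noteq> p0"
    using u zero_O by (auto simp: dvd_O_def)
  obtain v where v: "v \<in> left_ideal \<rho> L" "v $ q = 1" "v $ p0 = 0"
    using normalize_coordinate[OF \<rho> prime u(1,3)] u(2) \<open>q \<noteq> p0\<close> by metis
  \<comment> \<open>Clearing coordinate \<open>q\<close> of \<open>w\<close> leaves its 1 at
    \<open>p0\<close> intact, because \<open>v\<close> vanishes there.\<close>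
  have "w - (w $ q) *\<^sub>R v \<in> left_ideal \<rho> L"
    using w v by (intro left_ideal_diff left_ideal_scaleR OV_nth left_ideal_OV)
  then show ?thesis
    using w v \<open>q \<noteq> p0\<close>
    by (intro exI[of _ p0] exI[of _ q] bexI[of _ "w - (w $ q) *\<^sub>R v"] bexI[of _ v]) auto
qed

end

section \<open>Embedded number fields from the carrier-based definitions\<close>

lemma ring_of_type_algebra_simps [simp]:
  "carrier ring_of_type_algebra = UNIV"
  "x \<otimes>\<^bsub>ring_of_type_algebra\<^esub> y = x * y"
  "x \<oplus>\<^bsub>ring_of_type_algebra\<^esub> y = x + y"
  "\<one>\<^bsub>ring_of_type_algebra\<^esub> = 1"
  "\<zero>\<^bsub>ring_of_type_algebra\<^esub> = 0"
  by (simp_all add: ring_of_type_algebra_def)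

text \<open>Each line extension in the inductive definition of dimension contributes one
  generator.\<close>

lemma dimension_rat_span:
  fixes E :: "real set"
  assumes "ring.dimension (ring_of_type_algebra :: real ring) n \<rat> E"
  shows "\<exists>a :: nat \<Rightarrow> real. E = {\<Sum>i<n. r i * a i | r. \<forall>i. r i \<in> \<rat>}"
proof -
  interpret ring "ring_of_type_algebra :: real ring"
    by (rule ring_from_type_algebra)
  have "\<exists>a :: nat \<Rightarrow> real. E = {\<Sum>i<n. r i * a i | r. \<forall>i. r i \<in> \<rat>}"
    if "dimension n F E" "F = \<rat>" for F
    using that
  proof (induction n F E rule: dimension.induct)
    case (zero_dim F)
    show ?case
      by (auto intro!: exI[of _ "\<lambda>_. 0"])
  next
    case (Suc_dim v E n F)
    note F = \<open>F = \<rat>\<close>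
    show ?case
    proof -
      obtain a where a: "E = {\<Sum>i<n. r i * a i | r. \<forall>i. r i \<in> \<rat>}"
        using Suc_dim.IH[OF F] by blast
      have "line_extension F v E = {k * v + u | k u. k \<in> \<rat> \<and> u \<in> E}"
        unfolding line_extension_def set_add_def' r_coset_def F by auto
      also have "\<dots> = {\<Sum>i<Suc n. r i * (a(n := v)) i | r. \<forall>i. r i \<in> \<rat>}"
      proof (intro equalityI subsetI)
        fix x assume "x \<in> {k * v + u | k u. k \<in> \<rat> \<and> u \<in> E}"
        then obtain k r where kr: "k \<in> \<rat>" "\<forall>i. r i \<in> \<rat>" "x = k * v + (\<Sum>i<n. r i * a i)"
          by (auto simp: a)
        have "x = (\<Sum>i<Suc n. (r(n := k)) i * (a(n := v)) i)"
          by (simp add: kr(3))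
        moreover have "\<forall>i. (r(n := k)) i \<in> \<rat>"
          using kr by simp
        ultimately show "x \<in> {\<Sum>i<Suc n. r i * (a(n := v)) i | r. \<forall>i. r i \<in> \<rat>}"
          by blast
      next
        fix x assume "x \<in> {\<Sum>i<Suc n. r i * (a(n := v)) i | r. \<forall>i. r i \<in> \<rat>}"
        then obtain r where r: "\<forall>i. r i \<in> \<rat>" "x = r n * v + (\<Sum>i<n. r i * a i)"
          by auto
        then show "x \<in> {k * v + u | k u. k \<in> \<rat> \<and> u \<in> E}"
          unfolding a by blast
      qed
      finally show ?thesis
        by blast
    qed
  qed
  with assms show ?thesis
    by blast
qed

text \<open>Surjectivity of \<sigma> onto the real embeddings supplies the inclusion, and
  injectivity together with extensionality makes different indices differ at some field element.
  That sums and products of algebraic integers of \<open>K\<close> are again integers is read off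
  from the ring structure assumed on them.\<close>

lemma embedded_number_fieldI:
  fixes \<sigma> :: "'n::finite \<Rightarrow> real \<Rightarrow> real"
  assumes K: "number_field_of_degree CARD('n) K"
    and bij: "bij_betw \<sigma> UNIV (real_embeddings K)"
    and dom: "domain (ring_on (ring_of_integers K))"
  shows "embedded_number_field K \<sigma>"
proof
  interpret R: ring "ring_of_type_algebra :: real ring"
    by (rule ring_from_type_algebra)
  have sub: "subfield K ring_of_type_algebra" and dim: "ring.dimension ring_of_type_algebra CARD('n) \<rat> K"
    using K by (auto simp: number_field_of_degree_def)
  note subr = subringE[OF subfieldE(1)[OF sub], simplified]
  show "1 \<in> K" and "\<And>x y. x \<in> K \<Longrightarrow> y \<in> K \<Longrightarrow> x + y \<in> K" and "\<And>x y. x \<in> K \<Longrightarrow> y \<in> K \<Longrightarrow> x * y \<in> K"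
    using subr by auto
  show "- x \<in> K" if "x \<in> K" for x
  proof -
    have "x + \<ominus>\<^bsub>ring_of_type_algebra\<^esub> x = 0"
      using R.r_neg[of x] by simp
    then have "\<ominus>\<^bsub>ring_of_type_algebra\<^esub> x = - x"
      by linarith
    then show ?thesis
      using subringE(5)[OF subfieldE(1)[OF sub] that] by simp
  qed
  show "inverse x \<in> K" if "x \<in> K" for x
  proof (cases "x = 0")
    case False
    then have x: "x \<in> K - {\<zero>\<^bsub>ring_of_type_algebra\<^esub>}"
      using that by simp
    have "x * inv\<^bsub>ring_of_type_algebra\<^esub> x = 1"
      using R.subfield_m_inv(2)[OF sub x] by simp
    then have "inv\<^bsub>ring_of_type_algebra\<^esub> x = inverse x"
      by (rule inverse_unique[symmetric])
    then show ?thesis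
      using R.subfield_m_inv(1)[OF sub x] by simp
  qed (use that in simp)
  have emb: "\<sigma> s \<in> ring_hom (ring_on K) ring_of_type_algebra" "\<sigma> s \<in> extensional K" for s
    using bij by (auto simp: bij_betw_def real_embeddings_def)
  show "\<sigma> s 1 = 1" for s
    using ring_hom_one[OF emb(1)[of s]] by simp
  show "\<sigma> s (x + y) = \<sigma> s x + \<sigma> s y" if "x \<in> K" "y \<in> K" for s x y
    using ring_hom_add[OF emb(1)[of s], of x y] that by simp
  show "\<sigma> s (x * y) = \<sigma> s x * \<sigma> s y" if "x \<in> K" "y \<in> K" for s x y
    using ring_hom_mult[OF emb(1)[of s], of x y] that by simp
  show "\<exists>x\<in>K. \<sigma> s x \<noteq> \<sigma> t x" if "s \<noteq> t" for s t
  proof (rule ccontr)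
    assume "\<not> ?thesis"
    then have "\<sigma> s = \<sigma> t"
      using emb(2) by (intro extensionalityI[of _ K]) auto
    with that bij show False
      by (auto simp: bij_betw_def dest: injD)
  qed
  show "\<exists>s. \<forall>x\<in>K. \<sigma> s x = x"
  proof -
    have "restrict id K \<in> real_embeddings K"
      unfolding real_embeddings_def using subr
      by (auto intro!: ring_hom_memI)
    then obtain s where "\<sigma> s = restrict id K"
      using bij unfolding bij_betw_def by (metis imageE)
    then show ?thesis
      by (intro exI[of _ s]) auto
  qed
  show "\<exists>a. (\<forall>t::'n. a t \<in> K) \<and> (\<forall>x\<in>K. \<exists>r. (\<forall>t. r t \<in> \<rat>) \<and> x = (\<Sum>t\<in>UNIV. r t * a t))"
  proof -
    obtain a :: "nat \<Rightarrow> real" where a: "K = {\<Sum>i<CARD('n). r i * a i | r. \<forall>i. r i \<in> \<rat>}"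
      using dimension_rat_span[OF dim] by blast
    obtain e :: "'n \<Rightarrow> nat" where e: "bij_betw e UNIV {..<CARD('n)}"
      using ex_bij_betw_finite_nat[of "UNIV :: 'n set"] by (auto simp: lessThan_atLeast0)
    have sum_e: "(\<Sum>i<CARD('n). r i * a i) = (\<Sum>t\<in>UNIV. r (e t) * a (e t))" for r :: "nat \<Rightarrow> real"
      using sum.reindex_bij_betw[OF e, of "\<lambda>i. r i * a i"] by simp
    have "a (e t) \<in> K" for t
    proof -
      have "e t < CARD('n)"
        using e by (auto simp: bij_betw_def)
      then have "a (e t) = (\<Sum>i<CARD('n). (if i = e t then 1 else 0) * a i)"
        by (simp add: if_distribR if_distrib cong: if_cong)
      then show ?thesis
        unfolding a by (intro CollectI exI[of _ "\<lambda>i. if i = e t then 1 else 0"]) auto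
    qed
    moreover have "\<exists>r. (\<forall>t. r t \<in> \<rat>) \<and> x = (\<Sum>t\<in>UNIV. r t * a (e t))" if "x \<in> K" for x
    proof -
      obtain r where "\<forall>i. r i \<in> \<rat>" "x = (\<Sum>i<CARD('n). r i * a i)"
        using \<open>x \<in> K\<close> unfolding a by blast
      then show ?thesis
        by (intro exI[of _ "\<lambda>t. r (e t)"]) (auto simp: sum_e)
    qed
    ultimately show ?thesis
      by (intro exI[of _ "\<lambda>t. a (e t)"]) auto
  qed
  interpret O: domain "ring_on (ring_of_integers K)"
    by (rule dom)
  show "x + y \<in> ring_of_integers K" if "x \<in> ring_of_integers K" "y \<in> ring_of_integers K" for x y
    using O.a_closed[of x y] that by simp
  show "x * y \<in> ring_of_integers K" if "x \<in> ring_of_integers K" "y \<in> ring_of_integers K" for x y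
    using O.m_closed[of x y] that by simp
qed

section \<open>The lattice argument\<close>

context quaternion_order
begin

abbreviation "coord_matrix s \<equiv> quat_coord_matrix (\<sigma> s \<mu>) (\<sigma> s \<nu>) (\<sigma> s S) (\<sigma> s T)"

text \<open>The square-root-free norm form is carried over by the embedding. Total positivity of
  \<open>S\<close> and \<open>T\<close> provides the square roots in the conjugate matrix, so each
  conjugate of the norm is again a squared Euclidean length.\<close>

lemma emb_quat_norm:
  assumes v: "v \<in> OV"
  shows "\<sigma> s (quat_norm (comb v)) = (norm (coord_matrix s *v (\<chi> i. \<sigma> s (v $ i))))\<^sup>2"
proof -
  have [simp]: "v $ i \<in> K" "\<mu> \<in> K" "\<nu> \<in> K" "S \<in> K" "T \<in> K" for i
    using v \<mu>_O \<nu>_O S_O T_O by (auto simp: OV_def O_K)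
  have "\<sigma> s S > 0" "\<sigma> s T > 0"
    using S_tot_pos T_tot_pos by (auto simp: totally_positive_def)
  then show ?thesis
    unfolding quat_norm_comb[OF S_pos] quat_norm_comb_rational[OF S_pos T_pos]
    by (subst quat_norm_comb_rational)
      (simp_all add: emb_add emb_diff emb_mult emb_divide emb_power emb_numeral closed_K)
qed

lemma field_norm_T_pos: "field_norm \<sigma> T > 0"
  using T_tot_pos by (auto simp: totally_positive_def field_norm_def intro!: prod_pos)

lemma quat_norm_comb_K: "v \<in> OV \<Longrightarrow> quat_norm (comb v) \<in> K"
  unfolding quat_norm_comb[OF S_pos] quat_norm_comb_rational[OF S_pos T_pos]
  by (intro closed_K) (auto intro: O_K OV_nth \<mu>_O \<nu>_O S_O T_O)

text \<open>The lattice consists of the O_K-combinations of the vectors \<open>V j\<close>, seen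
  under all embeddings. The assumption \<open>bound\<close> is Minkowski's volume condition freed of
  roots and denominators; the fourth power of \<open>emb_det b\<close> is the squared
  discriminant.\<close>

lemma short_vector:
  fixes V :: "4 \<Rightarrow> real^4" and b :: "'n \<Rightarrow> real"
  assumes V: "\<And>j. V j \<in> OV" and b: "integral_basis K b"
    and det_V: "\<And>s. det (\<chi> i j. \<sigma> s (V i $ j)) = (\<sigma> s \<rho>)\<^sup>2"
    and \<rho>: "\<rho> \<in> O\<^sub>K" "\<rho> \<noteq> 0"
    and bound: "fact (4 * CARD('n)) * emb_det b ^ 4 * field_norm \<sigma> T
      < 3 ^ CARD('n) * pi ^ (2 * CARD('n)) * real CARD('n) ^ (4 * CARD('n)) * (field_norm \<sigma> \<rho>)\<^sup>2"
  shows "\<exists>x. (\<forall>j. x j \<in> O\<^sub>K) \<and> (\<Sum>j\<in>UNIV. x j *\<^sub>R V j) \<noteq> 0 \<and>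
    double_norm \<sigma> (comb (\<Sum>j\<in>UNIV. x j *\<^sub>R V j)) < (field_norm \<sigma> \<rho>)\<^sup>2"
proof -
  let ?n = "CARD('n)"
  define q where "q = \<bar>field_norm \<sigma> \<rho>\<bar>"
  define C where "C s = (\<chi> k j. \<sigma> s (V j $ k))" for s
  \<comment> \<open>One block per embedding: conjugates of the four O_K-coefficients go to the real
    components of the conjugate quaternion.\<close>
  define M1 :: "real^('n \<times> 4)^('n \<times> 4)" where
    "M1 = (\<chi> x y. if fst x = fst y then (coord_matrix (fst x) ** C (fst x)) $ snd x $ snd y else 0)"
  \<comment> \<open>One block per quaternion coordinate: integer coordinates go to the conjugates of
    an element of O_K. The four equal blocks produce the fourth power of
    \<open>emb_det b\<close>.\<close>
  define M2 :: "real^('n \<times> 4)^('n \<times> 4)" where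
    "M2 = (\<chi> x y. if snd x = snd y then \<sigma> (fst x) (b (fst y)) else 0)"
  define M where "M = M1 ** M2"
  define g :: "real^('n \<times> 4) \<Rightarrow> real" where "g y = (\<Sum>s\<in>UNIV. norm (\<chi> j. y $ (s, j)))" for y
  have q_pos: "q > 0"
    using field_norm_nonzero[OF O_K[OF \<rho>(1)] \<rho>(2)] by (simp add: q_def)
  have ST: "\<sigma> s S > 0" "\<sigma> s T > 0" for s
    using S_tot_pos T_tot_pos by (auto simp: totally_positive_def)
  have det_C: "det (C s) = (\<sigma> s \<rho>)\<^sup>2" for s
  proof -
    have "C s = transpose (\<chi> i j. \<sigma> s (V i $ j))"
      by (simp add: C_def transpose_def vec_eq_iff)
    then show ?thesis
      by (simp add: det_transpose det_V)
  qed
  have det_EC: "det (coord_matrix s ** C s) = \<sigma> s T / 4 * (\<sigma> s \<rho>)\<^sup>2" for s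
    by (simp add: det_mul det_C det_quat_coord_matrix ST)
  have EC_nz: "det (coord_matrix s ** C s) \<noteq> 0" for s
    unfolding det_EC using ST(2)[of s] emb_nonzero[OF O_K[OF \<rho>(1)] \<rho>(2), of s] by auto
  have bij1: "bij (\<lambda>(s :: 'n, j :: 4). (s, j))"
    by (simp add: case_prod_unfold bij_id[unfolded id_def])
  have bij2: "bij (\<lambda>(j :: 4, t :: 'n). (t, j))"
    by (rule bijI) (auto simp: inj_on_def image_iff)
  have M1_blocks: "M1 $ (s, i) $ (s', j) = (if s = s' then (coord_matrix s ** C s) $ i $ j else 0)" for s s' i j
    by (simp add: M1_def)
  have M2_blocks: "M2 $ (s, i) $ (t, j) = (if i = j then (\<chi> s t. \<sigma> s (b t)) $ s $ t else 0)" for s t i j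
    by (simp add: M2_def)
  have D_nz: "det (\<chi> s t. \<sigma> s (b t)) \<noteq> 0"
    using emb_det_integral_basis[OF b] by (simp add: emb_det_def)
  note M1 = abs_det_blocks[where h = Pair, OF bij1 M1_blocks EC_nz]
  note M2 = abs_det_blocks[where h = "\<lambda>j t. (t, j)", OF bij2 M2_blocks D_nz]
  have M_nz: "det M \<noteq> 0"
    using M1(1) M2(1) by (simp add: M_def det_mul)
  have det_M: "\<bar>det M\<bar> = field_norm \<sigma> T / 4 ^ ?n * q\<^sup>2 * emb_det b ^ 4"
  proof -
    have "\<bar>det M1\<bar> = (\<Prod>s\<in>UNIV. \<sigma> s T / 4 * (\<sigma> s \<rho>)\<^sup>2)"
      unfolding M1(2) using ST(2) by (intro prod.cong refl) (simp add: det_EC abs_mult less_imp_le)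
    also have "\<dots> = field_norm \<sigma> T / 4 ^ ?n * (field_norm \<sigma> \<rho>)\<^sup>2"
      by (simp add: prod.distrib prod_dividef field_norm_def prod_power_distrib)
    finally have "\<bar>det M1\<bar> = field_norm \<sigma> T / 4 ^ ?n * q\<^sup>2"
      by (simp add: q_def)
    moreover have "\<bar>det M2\<bar> = emb_det b ^ 4"
      unfolding M2(2) by (simp add: emb_det_def power_even_abs)
    ultimately show ?thesis
      by (simp add: M_def det_mul abs_mult)
  qed
  have [measurable]: "g \<in> borel_measurable borel"
    unfolding g_def by (intro borel_measurable_continuous_onI continuous_intros)
  have g_hom: "g (c *\<^sub>R y) = \<bar>c\<bar> * g y" for c y
  proof -
    have "(\<chi> j. (c *\<^sub>R y) $ (s, j)) = c *\<^sub>R (\<chi> j. y $ (s, j))" for s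
      by (simp add: vec_eq_iff)
    then show ?thesis
      by (simp add: g_def sum_distrib_left)
  qed
  have g_triangle: "g (y + y') \<le> g y + g y'" for y y'
  proof -
    have "(\<chi> j. (y + y') $ (s, j)) = (\<chi> j. y $ (s, j)) + (\<chi> j. y' $ (s, j))" for s
      by (simp add: vec_eq_iff)
    then show ?thesis
      by (simp only: g_def sum.distrib[symmetric]) (intro sum_mono norm_triangle_ineq)
  qed
  \<comment> \<open>Chosen so that a sum of \<open>?n\<close> norms below \<open>R\<close> has mean
    below the \<open>?n\<close>-th root of \<open>q\<close>, hence product below
    \<open>q\<close>.\<close>
  define R where "R = real ?n * root ?n q"
  have R_pos: "R > 0"
    using q_pos by (simp add: R_def)
  have R_pow: "R ^ (4 * ?n) = real ?n ^ (4 * ?n) * q ^ 4"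
  proof -
    have "root ?n q ^ (?n * 4) = q ^ 4"
      using q_pos by (simp add: power_mult real_root_pow_pos)
    then show ?thesis
      by (simp add: R_def power_mult_distrib mult.commute)
  qed
  define vol where "vol = (12 * pi\<^sup>2) ^ ?n / fact (4 * ?n)"
  have vol_nonneg: "vol \<ge> 0"
    by (simp add: vol_def)
  have "emeasure lborel {y. g y < R} = ennreal (R ^ (4 * ?n)) * emeasure lborel {y. g y < 1}"
    using emeasure_sublevel_homogeneous[of g R] R_pos by (simp add: g_hom mult.commute)
  also have "emeasure lborel {y. g y < 1} = ennreal vol"
    using emeasure_sum_norm_blocks[where 'n = 'n and 'b = 4]
    by (simp add: g_def vol_def unit_ball_vol_4 fact_numeral mult.commute)
  finally have vol_R: "emeasure lborel {y. g y < R} = ennreal (R ^ (4 * ?n) * vol)"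
    using R_pos vol_nonneg by (simp add: ennreal_mult)
  \<comment> \<open>The factor 16^n from Minkowski against 4^n from the covolume leaves 4^n, which
    is matched by 12^n = 4^n 3^n in the volume; this is the origin of 3^n in the bound.\<close>
  have large: "2 ^ (4 * ?n) * \<bar>det M\<bar> < R ^ (4 * ?n) * vol"
  proof -
    have "fact (4 * ?n) * (2 ^ (4 * ?n) * \<bar>det M\<bar>)
        = (4 ^ ?n * q\<^sup>2) * (fact (4 * ?n) * emb_det b ^ 4 * field_norm \<sigma> T)"
    proof -
      have "(2 :: real) ^ (4 * ?n) = 4 ^ ?n * 4 ^ ?n"
        by (simp add: power_mult flip: power_mult_distrib)
      then show ?thesis
        by (simp add: det_M)
    qed
    also have "\<dots> < (4 ^ ?n * q\<^sup>2) * (3 ^ ?n * pi ^ (2 * ?n) * real ?n ^ (4 * ?n) * (field_norm \<sigma> \<rho>)\<^sup>2)"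
      using bound q_pos by (intro mult_strict_left_mono) auto
    also have "\<dots> = fact (4 * ?n) * (R ^ (4 * ?n) * vol)"
    proof -
      have "(12 * pi\<^sup>2) ^ ?n = 4 ^ ?n * 3 ^ ?n * pi ^ (2 * ?n)"
        by (simp add: power_mult power_mult_distrib flip: power_mult_distrib[of 4 3])
      moreover have "q ^ 4 = q\<^sup>2 * (field_norm \<sigma> \<rho>)\<^sup>2"
        by (simp add: q_def flip: power_add)
      ultimately show ?thesis
        by (simp add: R_pow vol_def)
    qed
    finally show ?thesis
      by simp
  qed
  have "emeasure lborel {x. g (M *v x) < R} > 2 ^ CARD('n \<times> 4)"
  proof (rule ccontr)
    assume "\<not> ?thesis"
    then have "emeasure lborel {x. g (M *v x) < R} \<le> 2 ^ (4 * ?n)"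
      by (simp add: mult.commute)
    then have "ennreal \<bar>det M\<bar> * emeasure lborel {x. g (M *v x) < R} \<le> ennreal \<bar>det M\<bar> * ennreal (2 ^ (4 * ?n))"
      by (intro mult_left_mono) (auto simp flip: ennreal_power)
    moreover have "ennreal \<bar>det M\<bar> * emeasure lborel {x. g (M *v x) < R} = ennreal (R ^ (4 * ?n) * vol)"
      using emeasure_linear_vimage[OF M_nz, of "{y. g y < R}"] vol_R by simp
    ultimately have "ennreal (R ^ (4 * ?n) * vol) \<le> ennreal (2 ^ (4 * ?n) * \<bar>det M\<bar>)"
      by (simp add: mult.commute flip: ennreal_mult)
    with large show False
      by (subst (asm) ennreal_le_iff) auto
  qed
  then obtain z :: "int^('n \<times> 4)" where z: "z \<noteq> 0" "g (M *v (\<chi> i. of_int (z $ i))) < R"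
    using minkowski_gauge[of "\<lambda>x. g (M *v x)" R] R_pos g_hom g_triangle
    by (auto simp: matrix_vector_right_distrib matrix_vector_mult_scaleR)
  define x where "x j = (\<Sum>t\<in>UNIV. of_int (z $ (t, j)) * b t)" for j
  define m where "m = (\<Sum>j\<in>UNIV. x j *\<^sub>R V j)"
  have bK: "b t \<in> K" for t
    using integral_basis_mem[OF b] O_K by blast
  have xO: "x j \<in> O\<^sub>K" for j
    unfolding x_def by (intro sum_O mult_O of_int_O integral_basis_mem[OF b])
  have m_nth: "m $ k = (\<Sum>j\<in>UNIV. x j * V j $ k)" for k
    by (simp add: m_def)
  have mO: "m \<in> OV"
    by (auto simp: OV_def m_nth intro!: sum_O mult_O xO OV_nth V)
  have emb_m: "(\<chi> i. \<sigma> s (m $ i)) = C s *v (\<chi> j. \<sigma> s (x j))" for s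
    by (simp add: vec_eq_iff m_nth C_def matrix_vector_mult_def emb_sum emb_mult mult_K O_K[OF xO] O_K[OF OV_nth[OF V]] mult.commute)
  have emb_x: "\<sigma> s (x j) = (M2 *v (\<chi> i. of_int (z $ i))) $ (s, j)" for s j
  proof -
    have "(M2 *v (\<chi> i. of_int (z $ i))) $ (s, j)
        = (\<Sum>t\<in>UNIV. \<Sum>j'\<in>UNIV. M2 $ (s, j) $ (t, j') * of_int (z $ (t, j')))"
      unfolding matrix_vector_mult_def by (simp add: sum.cartesian_product case_prod_unfold)
    also have "\<dots> = (\<Sum>t\<in>UNIV. \<Sum>j'\<in>UNIV. if j' = j then \<sigma> s (b t) * of_int (z $ (t, j)) else 0)"
      by (intro sum.cong refl) (simp add: M2_blocks)
    also have "\<dots> = (\<Sum>t\<in>UNIV. \<sigma> s (b t) * of_int (z $ (t, j)))"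
      by simp
    finally show ?thesis
      by (simp add: x_def emb_sum emb_mult emb_of_int mult_K of_int_K bK mult.commute)
  qed
  have M_z: "(\<chi> i. (M *v (\<chi> i. of_int (z $ i))) $ (s, i)) = coord_matrix s *v (\<chi> i. \<sigma> s (m $ i))" for s
  proof -
    have "(M *v (\<chi> i. of_int (z $ i))) $ (s, i) = ((coord_matrix s ** C s) *v (\<chi> j. \<sigma> s (x j))) $ i" for i
    proof -
      let ?y = "M2 *v (\<chi> i. of_int (z $ i))"
      have "(M *v (\<chi> i. of_int (z $ i))) $ (s, i) = (M1 *v ?y) $ (s, i)"
        by (simp add: M_def matrix_vector_mul_assoc)
      also have "\<dots> = (\<Sum>s'\<in>UNIV. \<Sum>j\<in>UNIV. M1 $ (s, i) $ (s', j) * ?y $ (s', j))"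
        unfolding matrix_vector_mult_def[of M1] by (simp add: sum.cartesian_product case_prod_unfold)
      also have "\<dots> = (\<Sum>s'\<in>UNIV. if s' = s then \<Sum>j\<in>UNIV. (coord_matrix s ** C s) $ i $ j * ?y $ (s, j) else 0)"
        by (intro sum.cong refl) (simp add: M1_blocks)
      also have "\<dots> = (\<Sum>j\<in>UNIV. (coord_matrix s ** C s) $ i $ j * \<sigma> s (x j))"
        by (simp add: emb_x)
      finally show ?thesis
        unfolding matrix_vector_mult_def[of "coord_matrix s ** C s"] by simp
    qed
    then show ?thesis
      by (simp add: vec_eq_iff emb_m matrix_vector_mul_assoc)
  qed
  have "m \<noteq> 0"
  proof
    assume "m = 0"
    then have "(\<chi> i. (M *v (\<chi> i. of_int (z $ i))) $ (s, i)) = 0" for s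
      unfolding M_z by (simp add: emb_zero vec_eq_iff matrix_vector_mult_def)
    then have "M *v (\<chi> i. of_int (z $ i)) = 0"
      by (auto simp: vec_eq_iff)
    then have "(\<chi> i. of_int (z $ i)) = (0 :: real^('n \<times> 4))"
      using M_nz unfolding det_nonzero_iff_ker by blast
    with z(1) show False
      by (simp add: vec_eq_iff)
  qed
  moreover have "double_norm \<sigma> (comb m) < (field_norm \<sigma> \<rho>)\<^sup>2"
  proof -
    define N where "N s = norm (coord_matrix s *v (\<chi> i. \<sigma> s (m $ i)))" for s
    have sum_N: "(\<Sum>s\<in>UNIV. N s) < R"
      using z(2) by (simp add: g_def M_z N_def)
    have "(\<Prod>s\<in>UNIV. N s) powr (1 / ?n) \<le> (\<Sum>s\<in>UNIV. N s / ?n)"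
      by (rule arith_geom_mean) (auto simp: N_def)
    also have "\<dots> < root ?n q"
      using sum_N by (simp add: R_def field_simps flip: sum_divide_distrib)
    finally have "(\<Prod>s\<in>UNIV. N s) powr (1 / ?n) < root ?n q" .
    moreover have "(\<Prod>s\<in>UNIV. N s) powr (1 / ?n) = root ?n (\<Prod>s\<in>UNIV. N s)"
    proof (cases "(\<Prod>s\<in>UNIV. N s) = 0")
      case False
      moreover have "(\<Prod>s\<in>UNIV. N s) \<ge> 0"
        by (intro prod_nonneg) (simp add: N_def)
      ultimately show ?thesis
        by (intro root_powr_inverse[symmetric]) auto
    qed (simp only: powr_0 real_root_zero)
    ultimately have "root ?n (\<Prod>s\<in>UNIV. N s) < root ?n q"
      by simp
    then have "(\<Prod>s\<in>UNIV. N s) < q"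
      by simp
    then have "(\<Prod>s\<in>UNIV. N s)\<^sup>2 < q\<^sup>2"
      by (intro power_strict_mono prod_nonneg) (auto simp: N_def)
    moreover have "double_norm \<sigma> (comb m) = (\<Prod>s\<in>UNIV. N s)\<^sup>2"
      by (simp add: double_norm_def field_norm_def emb_quat_norm[OF mO] N_def prod_power_distrib)
    ultimately show ?thesis
      by (simp add: q_def)
  qed
  ultimately show ?thesis
    using xO by (intro exI[of _ x]) (auto simp: m_def)
qed

text \<open>Dividing a short vector of HL + \<rho>H by \<rho> gives an element of the required form,
  and its double norm shrinks by the factor N(\<rho>)^2, exactly the bound available before
  division.\<close>

theorem ideal_has_small_element:
  assumes \<rho>: "\<rho> \<in> O\<^sub>K" "\<rho> \<noteq> 0"
    and prime: "\<And>a b. a \<in> O\<^sub>K \<Longrightarrow> b \<in> O\<^sub>K \<Longrightarrow> dvd_O \<rho> (a * b) \<Longrightarrow> dvd_O \<rho> a \<or> dvd_O \<rho> b"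
    and T: "\<not> dvd_O \<rho> T"
    and b: "integral_basis K b"
    and bound: "fact (4 * CARD('n)) * emb_det b ^ 4 * field_norm \<sigma> T
      < 3 ^ CARD('n) * pi ^ (2 * CARD('n)) * real CARD('n) ^ (4 * CARD('n)) * (field_norm \<sigma> \<rho>)\<^sup>2"
    and L: "L \<in> H" "L \<notin> (\<lambda>M. \<rho> *\<^sub>R M) ` H"
  shows "\<exists>L'\<in>{D * (L /\<^sub>R \<rho>) + C | C D. C \<in> H \<and> D \<in> H}. L' \<noteq> 0 \<and> double_norm \<sigma> L' < 1"
proof -
  obtain l where l: "l \<in> OV" "L = comb l"
    using L(1) by (auto simp: H_eq)
  have "\<exists>p. \<not> dvd_O \<rho> (l $ p)"
  proof (rule ccontr)
    assume "\<not> ?thesis"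
    then obtain f where f: "\<And>p. f p \<in> O\<^sub>K" "\<And>p. l $ p = \<rho> * f p"
      unfolding dvd_O_def by metis
    then have "l = \<rho> *\<^sub>R (\<chi> p. f p)"
      by (simp add: vec_eq_iff)
    then have "L = \<rho> *\<^sub>R comb (\<chi> p. f p)"
      by (simp add: l(2) quat_comb_scaleR)
    with f(1) L(2) show False
      by (auto simp: H_eq OV_def)
  qed
  then obtain p0 where p0: "\<not> dvd_O \<rho> (l $ p0)" ..
  obtain p q v w where pq: "v \<in> left_ideal \<rho> L" "w \<in> left_ideal \<rho> L" "p \<noteq> q"
    "v $ p = 1" "v $ q = 0" "w $ p = 0" "w $ q = 1"
    using two_pivots[OF \<rho> prime T left_ideal_generator[OF l(1)] p0] unfolding l(2) by blast
  \<comment> \<open>The two pivot vectors, completed by \<rho> times the unit vectors in the other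
    two coordinates.\<close>
  define V where "V i = (if i = p then v else if i = q then w else \<rho> *\<^sub>R axis i 1)" for i
  have V: "V i \<in> left_ideal \<rho> L" for i
    using pq \<rho> by (auto simp: V_def intro: left_ideal_rho OV_axis)
  have det_V: "det (\<chi> i j. \<sigma> s (V i $ j)) = (\<sigma> s \<rho>)\<^sup>2" for s
  proof -
    have "(\<chi> i j. \<sigma> s (V i $ j)) = (\<chi> i. if i = p then (\<chi> j. \<sigma> s (v $ j)) else
        if i = q then (\<chi> j. \<sigma> s (w $ j)) else \<sigma> s \<rho> *\<^sub>R axis i 1)"
      by (auto simp: vec_eq_iff V_def axis_def emb_zero)
    then show ?thesis
      using pq by (simp add: det_two_pivots emb_zero emb_one)
  qed
  obtain x where x: "\<And>j. x j \<in> O\<^sub>K" "(\<Sum>j\<in>UNIV. x j *\<^sub>R V j) \<noteq> 0"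
    "double_norm \<sigma> (comb (\<Sum>j\<in>UNIV. x j *\<^sub>R V j)) < (field_norm \<sigma> \<rho>)\<^sup>2"
    using short_vector[OF left_ideal_OV[OF V] b det_V \<rho> bound] by blast
  define m where "m = (\<Sum>j\<in>UNIV. x j *\<^sub>R V j)"
  have "0 \<in> left_ideal \<rho> L"
    using left_ideal_rho[OF \<rho>(1) OV_zero] by simp
  then have m: "m \<in> left_ideal \<rho> L"
    unfolding m_def by (intro left_ideal_sum left_ideal_scaleR x(1) V)
  then obtain D C where DC: "D \<in> H" "C \<in> H" "comb m = D * L + \<rho> *\<^sub>R C"
    by (auto simp: left_ideal_def)
  define L' where "L' = comb m /\<^sub>R \<rho>"
  have "L' = D * (L /\<^sub>R \<rho>) + C"
    using \<rho>(2) by (simp add: L'_def DC(3) scaleR_add_right)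
  moreover have "L' \<noteq> 0"
  proof
    assume "L' = 0"
    then have "comb m = comb 0"
      using \<rho>(2) by (simp add: L'_def) (simp add: quat_comb_def)
    then have "m = 0"
      by (rule quat_comb_inj[OF S_pos T_pos])
    with x(2) show False
      by (simp add: m_def)
  qed
  moreover have "double_norm \<sigma> L' < 1"
  proof -
    have "quat_norm (comb m) = \<rho>\<^sup>2 * quat_norm L'"
      using \<rho>(2) by (simp add: L'_def quat_norm_def scaleR_quaternion_def power_mult_distrib power_inverse
          distrib_left mult.assoc[symmetric])
    then have "quat_norm L' = quat_norm (comb m) / \<rho>\<^sup>2"
      using \<rho>(2) by simp
    then have K': "quat_norm L' \<in> K"
      by (simp only:) (intro divide_K power_K quat_norm_comb_K left_ideal_OV[OF m] O_K[OF \<rho>(1)])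
    have "double_norm \<sigma> (comb m) = (field_norm \<sigma> \<rho>)\<^sup>2 * double_norm \<sigma> L'"
      unfolding double_norm_def \<open>quat_norm (comb m) = \<rho>\<^sup>2 * quat_norm L'\<close>
      by (simp add: field_norm_mult field_norm_power K' power_K O_K[OF \<rho>(1)])
    with x(3) have "(field_norm \<sigma> \<rho>)\<^sup>2 * double_norm \<sigma> L' < (field_norm \<sigma> \<rho>)\<^sup>2 * 1"
      by (simp add: m_def)
    then show ?thesis
      by (rule mult_left_less_imp_less) simp
  qed
  ultimately show ?thesis
    using DC by blast
qed

end

theorem theorem4p6:
  fixes K :: "real set"
    and \<sigma> :: "'n::finite \<Rightarrow> real \<Rightarrow> real"
    and A B \<mu> \<nu> S T \<rho> :: real
    and n :: nat
  assumes "n = CARD('n)"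
    and "number_field_of_degree n K"
    and "totally_real K"
    and "bij_betw \<sigma> UNIV (real_embeddings K)"
    and "factorial_domain (ring_on (ring_of_integers K))"
    and "A \<in> ring_of_integers K" and "B \<in> ring_of_integers K"
    and "\<mu> \<in> ring_of_integers K" and "\<nu> \<in> ring_of_integers K"
    and "S = 4 * A - \<mu>\<^sup>2" and "T = B * S - \<nu>\<^sup>2"
    and "totally_positive \<sigma> S" and "totally_positive \<sigma> T"
    and "prime_element K \<rho>"
    and "\<not> (\<rho> divides\<^bsub>ring_on (ring_of_integers K)\<^esub> T)"
    and "\<bar>field_norm \<sigma> \<rho>\<bar> >
           sqrt (fact (4 * n)) / (pi ^ n * 3 powr (real n / 2) * real n ^ (2 * n))
             * (discriminant K \<sigma> * sqrt (field_norm \<sigma> T))"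
  shows "quat_suitable K \<sigma> (quat_order K \<mu> \<nu> S T) \<rho>"
proof -
  have "domain (ring_on (ring_of_integers K))"
    using assms(5) by (rule factorial_domain.axioms(1))
  then interpret embedded_number_field K \<sigma>
    using assms(1,2,4) by (intro embedded_number_fieldI) auto
  interpret quaternion_order K \<sigma> A B \<mu> \<nu> S T
    using assms by unfold_locales auto
  have dvd_iff: "dvd_O \<rho> x \<longleftrightarrow> \<rho> divides\<^bsub>ring_on O\<^sub>K\<^esub> x" for x
    by (simp add: dvd_O_def factor_def Bex_def)
  have \<rho>: "\<rho> \<in> O\<^sub>K" "\<rho> \<noteq> 0"
    and prime: "\<And>a b. a \<in> O\<^sub>K \<Longrightarrow> b \<in> O\<^sub>K \<Longrightarrow> dvd_O \<rho> (a * b) \<Longrightarrow> dvd_O \<rho> a \<or> dvd_O \<rho> b"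
    using \<open>prime_element K \<rho>\<close> by (auto simp: prime_element_def ring_prime_def prime_def dvd_iff)
  \<comment> \<open>This is literally the basis chosen inside \<open>discriminant\<close>, so no
    independence of the choice is called for.\<close>
  define b where "b = (SOME b :: 'n \<Rightarrow> real. integral_basis K b)"
  have b: "integral_basis K b"
    unfolding b_def using integral_basis_exists by (rule someI_ex)
  have disc: "discriminant K \<sigma> = (emb_det b)\<^sup>2"
    by (simp add: discriminant_def emb_det_def b_def Let_def)
  \<comment> \<open>Both sides are nonnegative, so squaring the hypothesis removes the square roots
    and the half-integral power of 3.\<close>
  let ?c = "pi ^ n * 3 powr (real n / 2) * real n ^ (2 * n)"
  let ?y = "sqrt (fact (4 * n)) * ((emb_det b)\<^sup>2 * sqrt (field_norm \<sigma> T))"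
  have "n > 0"
    using assms(1) by simp
  then have c_pos: "?c > 0"
    by simp
  have "?y < ?c * \<bar>field_norm \<sigma> \<rho>\<bar>"
    using assms(16) c_pos unfolding disc by (simp add: field_simps)
  moreover have "?y \<ge> 0"
    using field_norm_T_pos by simp
  ultimately have "?y\<^sup>2 < (?c * \<bar>field_norm \<sigma> \<rho>\<bar>)\<^sup>2"
    by (intro power_strict_mono) auto
  moreover have "?y\<^sup>2 = fact (4 * n) * emb_det b ^ 4 * field_norm \<sigma> T"
    using field_norm_T_pos by (simp add: power_mult_distrib flip: power_mult)
  moreover have "(?c * \<bar>field_norm \<sigma> \<rho>\<bar>)\<^sup>2
      = 3 ^ n * pi ^ (2 * n) * real n ^ (4 * n) * (field_norm \<sigma> \<rho>)\<^sup>2"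
  proof -
    have "(3 powr (real n / 2))\<^sup>2 = (3 :: real) ^ n"
      by (simp add: power2_eq_square powr_realpow flip: powr_add)
    then show ?thesis
      by (simp add: power_mult_distrib mult_ac flip: power_mult)
  qed
  ultimately have bound: "fact (4 * CARD('n)) * emb_det b ^ 4 * field_norm \<sigma> T
      < 3 ^ CARD('n) * pi ^ (2 * CARD('n)) * real CARD('n) ^ (4 * CARD('n)) * (field_norm \<sigma> \<rho>)\<^sup>2"
    unfolding assms(1) by simp
  have "\<not> dvd_O \<rho> T"
    using assms(15) by (simp add: dvd_iff)
  from ideal_has_small_element[OF \<rho> prime this b bound] show ?thesis
    unfolding quat_suitable_def using \<open>prime_element K \<rho>\<close> by blast
qed

end
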